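(* Let $\Bbbk$ be an algebraically closed field of characteristic zero, let $1\le a\le b\le c$ be integers with $\gcd(a,b,c)=1$, and let $A=\Bbbk[x,y,z]$ be graded by $\deg x=a$, $\deg y=b$, $\deg z=c$. The following is a complete list, up to graded algebra automorphisms of $A$, of the nonzero homogeneous elements $\Omega\in A$ of degree $a+b+c$ having an isolated singularity (in particular such $\Omega$ exist only for the three listed weights): (1) $\Omega_1=x^3+y^3+z^3+\lambda xyz$ with $\lambda\in\Bbbk$, $(-\lambda)^3\neq 3\cdot 3\cdot 3=27$, and $(a,b,c)=(1,1,1)$; (2) $\Omega_2=x^4+y^4+z^2+\lambda xyz$ with $\lambda\in\Bbbk$, $(-\lambda)^4\neq 4\cdot 4\cdot 2^2=64$, and $(a,b,c)=(1,1,2)$; (3) $\Omega_3=x^6+y^3+z^2+\lambda xyz$ with $\lambda\in\Bbbk$, $(-\lambda)^6\neq 6\cdot 3^2\cdot 2^3=432$, and $(a,b,c)=(1,2,3)$.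
   Context: A homogeneous $\Omega\in\Bbbk[x,y,z]$ has an isolated singularity if the partial derivatives $\Omega_x,\Omega_y,\Omega_z$ vanish simultaneously only at the origin, i.e. $\Bbbk[x,y,z]/(\Omega_x,\Omega_y,\Omega_z)$ is finite-dimensional over $\Bbbk$. "Up to graded automorphisms" means: after applying a degree-preserving $\Bbbk$-algebra automorphism of $A$. *)

theory Defs
  imports "HOL-Computational_Algebra.Computational_Algebra"
begin

text \<open>
  \<open>\<k>[x,y,z]\<close> is the iterated polynomial ring \<open>\<k>[x][y][z]\<close>: \<open>x\<close> is the innermost and \<open>z\<close> the
  outermost variable.
\<close>

type_synonym 'k poly3 = "'k poly poly poly"

definition const3 :: "'k::comm_semiring_1 \<Rightarrow> 'k poly3" where
  "const3 c = [:[:[:c:]:]:]"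

definition X :: "'k::comm_semiring_1 poly3" where
  "X = [:[:[:0, 1:]:]:]"

definition Y :: "'k::comm_semiring_1 poly3" where
  "Y = [:[:0, 1:]:]"

definition Z :: "'k::comm_semiring_1 poly3" where
  "Z = [:0, 1:]"

text \<open>The coefficient of \<open>x\<^sup>i y\<^sup>j z\<^sup>k\<close>.\<close>

definition coeff3 :: "'k::zero poly3 \<Rightarrow> nat \<Rightarrow> nat \<Rightarrow> nat \<Rightarrow> 'k" where
  "coeff3 p i j k = coeff (coeff (coeff p k) j) i"

definition eval3 :: "'k::comm_semiring_1 poly3 \<Rightarrow> 'k \<Rightarrow> 'k \<Rightarrow> 'k \<Rightarrow> 'k" where
  "eval3 p u v w = poly (poly (poly p [:[:w:]:]) [:v:]) u"

definition dX :: "'k::field poly3 \<Rightarrow> 'k poly3" where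
  "dX = map_poly (map_poly pderiv)"

definition dY :: "'k::field poly3 \<Rightarrow> 'k poly3" where
  "dY = map_poly pderiv"

definition dZ :: "'k::field poly3 \<Rightarrow> 'k poly3" where
  "dZ = pderiv"

text \<open>
  The graded piece of degree \<open>d\<close> for the weights \<open>deg x = a\<close>, \<open>deg y = b\<close>, \<open>deg z = c\<close>; it
  contains \<open>0\<close>.
\<close>

definition graded_piece :: "nat \<Rightarrow> nat \<Rightarrow> nat \<Rightarrow> nat \<Rightarrow> 'k::zero poly3 set" where
  "graded_piece a b c d =
     {p. \<forall>i j k. coeff3 p i j k \<noteq> 0 \<longrightarrow> a * i + b * j + c * k = d}"

definition isolated_singularity :: "'k::field poly3 \<Rightarrow> bool" where
  "isolated_singularity p \<longleftrightarrow>
     (\<forall>u v w. eval3 (dX p) u v w = 0 \<and> eval3 (dY p) u v w = 0 \<and> eval3 (dZ p) u v w = 0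
        \<longrightarrow> u = 0 \<and> v = 0 \<and> w = 0)"

text \<open>
  \<open>\<k>\<close>-algebra automorphisms of \<open>\<k>[x,y,z]\<close> that carry each graded piece onto itself. Fixing the
  constants is \<open>\<k>\<close>-linearity (given multiplicativity) and preservation of \<open>1\<close>.
\<close>

definition graded_automorphism ::
    "nat \<Rightarrow> nat \<Rightarrow> nat \<Rightarrow> ('k::field poly3 \<Rightarrow> 'k poly3) \<Rightarrow> bool" where
  "graded_automorphism a b c \<phi> \<longleftrightarrow>
     bij \<phi> \<and>
     (\<forall>p q. \<phi> (p + q) = \<phi> p + \<phi> q) \<and>
     (\<forall>p q. \<phi> (p * q) = \<phi> p * \<phi> q) \<and>
     (\<forall>t. \<phi> (const3 t) = const3 t) \<and>
     (\<forall>d. \<phi> ` graded_piece a b c d = graded_piece a b c d)"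

end

(*
  An isolated singularity forces, near the z-axis and near the y-axis, a monomial that makes a partial
  derivative nonzero there. For degree a + b + c this leaves c = a + b with b | 2a, or b = c, and in the
  latter case a = b. So the weights are (1,1,1), (1,1,2) or (1,2,3).

  For (1,2,3) and (1,1,2) one completes the square in z and normalises the remaining cubic in y and x^2,
  respectively the binary quartic in x and y; a final shear z -> z + m x y trades the term x^2 y^2 for x y z.
  For (1,1,1) one finds a flex of the cubic by elimination, brings the cubic into Weierstrass form, then
  writes it as (x + y + z)^3 + kappa x y z by means of three collinear flexes with their tangents, and
  diagonalises with cube roots of unity.

  Isolatedness is invariant under graded automorphisms by the chain rule, since the point maps of such an
  automorphism and of its inverse fix the origin. It therefore supplies the nonvanishing of the coefficients
  met on the way, and it determines the excluded values of lambda.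
*)

theory Submission
  imports Defs
begin

section \<open>Polynomials in three variables\<close>

text \<open>The cubic case is the hard one. Its route is dictated by the factorisation of
  \<open>u^3 + v^3 + t^3 - 3 u v t\<close> into three linear forms with sum \<open>3 u\<close>,
  which suggests aiming for a cube of the sum of three coordinates plus a multiple of their product.
  On a cubic \<open>L^3 + \<kappa> L1 L2 L3\<close> each line \<open>Li = 0\<close> meets the curve
  only where \<open>L = 0\<close>, with multiplicity three, so the lines are tangents at three
  collinear flexes. Hence a flex has to be found first. This is done without Hessian curves or
  intersection numbers: a flex tangent is a line on which the cubic becomes a cube, and eliminating
  its parameters leaves one equation in one unknown, of degree 9, the number of flexes of a smooth
  cubic.\<close>

lemma poly3_induct [case_names const X Y Z add mult]:
  fixes p :: "'k::comm_ring_1 poly3"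
  assumes const: "\<And>t. P (const3 t)" and X: "P X" and Y: "P Y" and Z: "P Z"
    and add: "\<And>p q. P p \<Longrightarrow> P q \<Longrightarrow> P (p + q)"
    and mult: "\<And>p q. P p \<Longrightarrow> P q \<Longrightarrow> P (p * q)"
  shows "P p"
proof -
  have 0: "P 0" using const[of 0] by (simp add: const3_def)
  have x: "P [:[:r:]:]" for r
  proof (induction r)
    case (pCons t r)
    have "[:[:pCons t r:]:] = const3 t + X * [:[:r:]:]"
      by (simp add: const3_def X_def)
    then show ?case using pCons const X add mult by metis
  qed (simp add: 0)
  have y: "P [:q:]" for q
  proof (induction q)
    case (pCons r q)
    have "[:pCons r q:] = [:[:r:]:] + Y * [:q:]" by (simp add: Y_def)
    then show ?case using pCons x Y add mult by metis
  qed (simp add: 0)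
  show ?thesis
  proof (induction p)
    case (pCons q p)
    have "pCons q p = [:q:] + Z * p" by (simp add: Z_def)
    then show ?case using pCons y Z add mult by metis
  qed (rule 0)
qed

lemma const3_simps [simp]:
  "const3 0 = 0" "const3 1 = 1"
  "const3 (s + t) = const3 s + const3 t" "const3 (s * t) = const3 s * const3 t"
  by (simp_all add: const3_def one_pCons mult.commute)

lemma const3_minus [simp]: "const3 (- t) = - const3 (t :: 'k::comm_ring_1)"
  by (simp add: const3_def)

lemma eval3_simps [simp]:
  fixes p q :: "'k::comm_ring_1 poly3"
  shows "eval3 0 u v w = (0 :: 'k)" "eval3 1 u v w = (1 :: 'k)"
    "eval3 (const3 t) u v w = t"
    "eval3 X u v w = u" "eval3 Y u v w = v" "eval3 Z u v w = w"
    "eval3 (p + q) u v w = eval3 p u v w + eval3 q u v w"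
    "eval3 (p * q) u v w = eval3 p u v w * eval3 q u v w"
    "eval3 (- p) u v w = - eval3 p u v w"
    "eval3 (p - q) u v w = eval3 p u v w - eval3 q u v w"
    "eval3 (p ^ n) u v w = eval3 p u v w ^ n"
    "eval3 (numeral m) u v w = numeral m"
  by (simp_all add: eval3_def const3_def X_def Y_def Z_def poly_power numeral_poly)

lemma eval3_sum: "eval3 (sum f A) u v w = (\<Sum>x\<in>A. eval3 (f x) u v w)"
  for f :: "'a \<Rightarrow> 'k::comm_ring_1 poly3"
  by (induction A rule: infinite_finite_induct) simp_all

text \<open>The field is infinite because its characteristic is zero. This turns every later
  identity between substituted polynomials into a computation with field elements.\<close>

lemma poly3_eqI:
  fixes p q :: "'k::field_char_0 poly3"
  assumes "\<And>u v w. eval3 p u v w = eval3 q u v w"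
  shows "p = q"
proof -
  have "r = 0" if r: "\<And>u v w. eval3 r u v w = 0" for r :: "'k poly3"
  proof (rule ccontr)
    assume "r \<noteq> 0"
    \<comment> \<open>One variable is specialised at a time: the constants form an infinite subset
      of the coefficient ring, so they cannot all be roots of a nonzero polynomial.\<close>
    have inf: "infinite (range (\<lambda>t::'k. [:[:t:]:]))"
      using finite_imageD[of "\<lambda>t::'k. [:[:t:]:]" UNIV] infinite_UNIV_char_0 by (auto simp: inj_on_def)
    have "\<not> range (\<lambda>t::'k. [:[:t:]:]) \<subseteq> {s. poly r s = 0}"
      using poly_roots_finite[OF \<open>r \<noteq> 0\<close>] inf finite_subset by blast
    then obtain w where w: "poly r [:[:w:]:] \<noteq> 0" by auto
    have inf1: "infinite (range (\<lambda>t::'k. [:t:]))"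
      using finite_imageD[of "\<lambda>t::'k. [:t:]" UNIV] infinite_UNIV_char_0 by (auto simp: inj_on_def)
    have "\<not> range (\<lambda>t::'k. [:t:]) \<subseteq> {s. poly (poly r [:[:w:]:]) s = 0}"
      using poly_roots_finite[OF w] inf1 finite_subset by blast
    then obtain v where v: "poly (poly r [:[:w:]:]) [:v:] \<noteq> 0" by auto
    have "\<not> UNIV \<subseteq> {s. poly (poly (poly r [:[:w:]:]) [:v:]) s = 0}"
      using poly_roots_finite[OF v] infinite_UNIV_char_0 finite_subset by blast
    then show False using r by (auto simp: eval3_def)
  qed
  from this[of "p - q"] show ?thesis using assms by simp
qed

section \<open>Partial derivatives as derivations\<close>

lemma map_poly_add_hom:
  assumes "\<And>x y. h (x + y) = h x + h y" and "h 0 = 0"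
  shows "map_poly h (p + q) = map_poly h p + map_poly h q"
  using assms by (intro poly_eqI) (simp add: coeff_map_poly)

text \<open>Iterating this carries the derivative in \<open>x\<close> or \<open>y\<close> through
  the outer polynomial layers.\<close>

lemma map_poly_leibniz:
  fixes D :: "'a::comm_ring_1 \<Rightarrow> 'a"
  assumes add: "\<And>x y. D (x + y) = D x + D y"
    and mult: "\<And>x y. D (x * y) = x * D y + y * D x"
  shows "map_poly D (p * q) = p * map_poly D q + q * map_poly D p"
proof -
  have 0: "D 0 = 0" using add[of 0 0] by simp
  note add' = map_poly_add_hom[of D, OF add 0]
  have sm: "map_poly D (smult t q) = smult t (map_poly D q) + smult (D t) q" for t
    by (rule poly_eqI) (simp add: coeff_map_poly 0 mult mult.commute)
  show ?thesis
  proof (induction p)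
    case (pCons t p)
    then show ?case
      by (simp add: add' sm map_poly_pCons 0 algebra_simps)
  qed simp
qed

lemma dX_simps [simp]:
  fixes p q :: "'k::field poly3"
  shows "dX (p + q) = dX p + dX q" "dX (p * q) = p * dX q + q * dX p"
    "dX (const3 t) = (0 :: 'k poly3)"
    "dX X = (1 :: 'k poly3)" "dX Y = (0 :: 'k poly3)" "dX Z = (0 :: 'k poly3)"
proof -
  have add: "map_poly pderiv (r + s) = map_poly pderiv r + map_poly pderiv s" for r s :: "'k poly poly"
    by (rule map_poly_add_hom) (simp_all add: pderiv_add)
  have mult: "map_poly pderiv (r * s) = r * map_poly pderiv s + s * map_poly pderiv r"
    for r s :: "'k poly poly"
    by (rule map_poly_leibniz) (simp_all add: pderiv_add pderiv_mult)
  show "dX (p + q) = dX p + dX q" unfolding dX_def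
    by (rule map_poly_add_hom) (simp_all add: add)
  show "dX (p * q) = p * dX q + q * dX p" unfolding dX_def
    by (rule map_poly_leibniz) (simp_all add: add mult)
qed (simp_all add: dX_def const3_def X_def Y_def Z_def map_poly_pCons one_pCons pderiv_pCons)

lemma dY_simps [simp]:
  fixes p q :: "'k::field poly3"
  shows "dY (p + q) = dY p + dY q" "dY (p * q) = p * dY q + q * dY p"
    "dY (const3 t) = (0 :: 'k poly3)"
    "dY X = (0 :: 'k poly3)" "dY Y = (1 :: 'k poly3)" "dY Z = (0 :: 'k poly3)"
proof -
  show "dY (p + q) = dY p + dY q" unfolding dY_def
    by (rule map_poly_add_hom) (simp_all add: pderiv_add)
  show "dY (p * q) = p * dY q + q * dY p" unfolding dY_def
    by (rule map_poly_leibniz) (simp_all add: pderiv_add pderiv_mult)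
qed (simp_all add: dY_def const3_def X_def Y_def Z_def map_poly_pCons one_pCons pderiv_pCons)

lemma dZ_simps [simp]:
  fixes p q :: "'k::field poly3"
  shows "dZ (p + q) = dZ p + dZ q" "dZ (p * q) = p * dZ q + q * dZ p"
    "dZ (const3 t) = (0 :: 'k poly3)"
    "dZ X = (0 :: 'k poly3)" "dZ Y = (0 :: 'k poly3)" "dZ Z = (1 :: 'k poly3)"
  by (simp_all add: dZ_def const3_def X_def Y_def Z_def one_pCons pderiv_pCons pderiv_add pderiv_mult)

lemma derivation_power:
  fixes D :: "'a::comm_ring_1 \<Rightarrow> 'a"
  assumes mult: "\<And>x y. D (x * y) = x * D y + y * D x"
  shows "D (x ^ n) = of_nat n * x ^ (n - 1) * D x"
proof (induction n)
  case 0
  then show ?case using mult[of 1 1] by simp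
next
  case (Suc n)
  then show ?case by (cases n) (simp_all add: mult algebra_simps)
qed

lemmas d_power [simp] =
  derivation_power[of dX, OF dX_simps(2)]
  derivation_power[of dY, OF dY_simps(2)]
  derivation_power[of dZ, OF dZ_simps(2)]

lemma eval3_of_nat [simp]: "eval3 (of_nat n) u v w = (of_nat n :: 'k::comm_ring_1)"
  by (induction n) simp_all

lemma derivation_sum:
  assumes "\<And>x y. D (x + y) = D x + D y" and "D 0 = 0"
  shows "D (sum f A) = (\<Sum>x\<in>A. D (f x))"
  using assms by (induction A rule: infinite_finite_induct) simp_all

section \<open>Substitutions\<close>

text \<open>The algebra endomorphism sending \<open>X\<close>, \<open>Y\<close>, \<open>Z\<close> to
  \<open>P\<close>, \<open>Q\<close>, \<open>R\<close>, built from one evaluation homomorphism per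
  layer.\<close>

definition subst3 :: "'k::comm_ring_1 poly3 \<Rightarrow> 'k poly3 \<Rightarrow> 'k poly3 \<Rightarrow> 'k poly3 \<Rightarrow> 'k poly3" where
  "subst3 P Q R p =
     poly (map_poly (\<lambda>q. poly (map_poly (\<lambda>r. poly (map_poly const3 r) P) q) Q) p) R"

lemma poly_map_poly_hom:
  fixes h :: "'a::comm_ring_1 \<Rightarrow> 'b::comm_ring_1"
  assumes add: "\<And>x y. h (x + y) = h x + h y" and mult: "\<And>x y. h (x * y) = h x * h y"
  shows "poly (map_poly h (p + q)) r = poly (map_poly h p) r + poly (map_poly h q) r"
    and "poly (map_poly h (p * q)) r = poly (map_poly h p) r * poly (map_poly h q) r"
    and "poly (map_poly h [:t:]) r = h t"
proof -
  have 0: "h 0 = 0" using add[of 0 0] by simp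
  note add' = map_poly_add_hom[of h, OF add 0]
  have sm: "poly (map_poly h (smult t q)) r = h t * poly (map_poly h q) r" for t
    by (induction q) (simp_all add: map_poly_pCons 0 mult algebra_simps)
  show "poly (map_poly h (p + q)) r = poly (map_poly h p) r + poly (map_poly h q) r"
    by (simp add: add')
  show "poly (map_poly h (p * q)) r = poly (map_poly h p) r * poly (map_poly h q) r"
    by (induction p) (simp_all add: map_poly_pCons 0 add' sm algebra_simps)
  show "poly (map_poly h [:t:]) r = h t"
    by (simp add: map_poly_pCons 0)
qed

lemma subst3_simps [simp]:
  fixes P Q R p q :: "'k::comm_ring_1 poly3"
  shows "subst3 P Q R (p + q) = subst3 P Q R p + subst3 P Q R q"
    "subst3 P Q R (p * q) = subst3 P Q R p * subst3 P Q R q"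
    "subst3 P Q R (const3 t) = const3 t"
    "subst3 P Q R X = P" "subst3 P Q R Y = Q" "subst3 P Q R Z = R"
proof -
  note h1 = poly_map_poly_hom[of "const3 :: 'k \<Rightarrow> _", OF const3_simps(3,4), where r = P]
  note h2 = poly_map_poly_hom[of "\<lambda>r. poly (map_poly const3 r) P", OF h1(1,2), where r = Q]
  note h3 = poly_map_poly_hom[of "\<lambda>q. poly (map_poly (\<lambda>r. poly (map_poly const3 r) P) q) Q",
      OF h2(1,2), where r = R]
  show "subst3 P Q R (p + q) = subst3 P Q R p + subst3 P Q R q"
    "subst3 P Q R (p * q) = subst3 P Q R p * subst3 P Q R q"
    unfolding subst3_def by (rule h3)+
qed (simp_all add: subst3_def const3_def X_def Y_def Z_def map_poly_pCons flip: one_pCons)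

text \<open>An algebra endomorphism is pullback along the polynomial map whose coordinates are the
  images of the variables.\<close>

lemma eval3_hom:
  fixes \<phi> :: "'k::comm_ring_1 poly3 \<Rightarrow> 'k poly3"
  assumes "\<And>p q. \<phi> (p + q) = \<phi> p + \<phi> q" and "\<And>p q. \<phi> (p * q) = \<phi> p * \<phi> q"
    and "\<And>t. \<phi> (const3 t) = const3 t"
  shows "eval3 (\<phi> p) u v w = eval3 p (eval3 (\<phi> X) u v w) (eval3 (\<phi> Y) u v w) (eval3 (\<phi> Z) u v w)"
  by (induction p rule: poly3_induct) (simp_all add: assms)

lemma eval3_subst3 [simp]:
  "eval3 (subst3 P Q R p) u v w = eval3 p (eval3 P u v w) (eval3 Q u v w) (eval3 R u v w)"
  for p :: "'k::comm_ring_1 poly3"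
  using eval3_hom[of "subst3 P Q R" p u v w] by simp

text \<open>Both sides are derivations along \<open>\<phi>\<close> and agree on the generators.
  \<open>D\<close> stays arbitrary so that one proof serves all three partials.\<close>

lemma chain_rule:
  fixes \<phi> D :: "'k::field poly3 \<Rightarrow> 'k poly3"
  assumes "\<And>p q. \<phi> (p + q) = \<phi> p + \<phi> q" and "\<And>p q. \<phi> (p * q) = \<phi> p * \<phi> q"
    and "\<And>t. \<phi> (const3 t) = const3 t"
    and "\<And>p q. D (p + q) = D p + D q" and "\<And>p q. D (p * q) = p * D q + q * D p"
    and "\<And>t. D (const3 t) = 0"
  shows "D (\<phi> p) = \<phi> (dX p) * D (\<phi> X) + \<phi> (dY p) * D (\<phi> Y) + \<phi> (dZ p) * D (\<phi> Z)"
proof -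
  have "\<phi> 0 = 0" "\<phi> 1 = 1" using assms(3)[of 0] assms(3)[of 1] by simp_all
  then show ?thesis
    by (induction p rule: poly3_induct) (simp_all add: assms algebra_simps)
qed

section \<open>The grading\<close>

lemma coeff3_simps [simp]:
  "coeff3 0 i j k = 0"
  "coeff3 (p + q) i j k = coeff3 p i j k + coeff3 q i j k"
  for p q :: "'k::comm_ring_1 poly3"
  by (simp_all add: coeff3_def)

lemma coeff3_sum: "coeff3 (sum f A) i j k = (\<Sum>x\<in>A. coeff3 (f x) i j k)"
  by (simp add: coeff3_def coeff_sum)

lemma coeff3_eqI:
  assumes "\<And>i j k. coeff3 p i j k = coeff3 q i j k"
  shows "p = q"
  using assms by (auto simp: coeff3_def poly_eq_iff)

lemma coeff3_mult:
  "coeff3 (p * q) i j k =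
     (\<Sum>k'\<le>k. \<Sum>j'\<le>j. \<Sum>i'\<le>i. coeff3 p i' j' k' * coeff3 q (i - i') (j - j') (k - k'))"
  by (simp add: coeff3_def coeff_mult coeff_sum)

lemma monom3_conv:
  "const3 t * X ^ i * Y ^ j * Z ^ k = monom (monom (monom t i) j) k"
  for t :: "'k::comm_ring_1"
proof -
  have "X ^ i = monom (monom (monom (1::'k) i) 0) 0"
    by (induction i) (simp_all add: X_def one_pCons mult_monom monom_0 monom_Suc)
  moreover have "Y ^ j = monom (monom (1::'k poly) j) 0"
    by (induction j) (simp_all add: Y_def one_pCons mult_monom monom_0 monom_Suc flip: one_pCons)
  moreover have "Z ^ k = monom (1::'k poly poly) k"
    by (induction k) (simp_all add: Z_def one_pCons mult_monom monom_0 monom_Suc flip: one_pCons)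
  moreover have "const3 t = monom (monom (monom t 0) 0) 0"
    by (simp add: const3_def monom_0)
  ultimately show ?thesis
    by (simp add: mult_monom)
qed

lemma coeff3_monom:
  "coeff3 (const3 t * X ^ i * Y ^ j * Z ^ k) i' j' k' = (if i' = i \<and> j' = j \<and> k' = k then t else 0)"
  for t :: "'k::comm_ring_1"
  unfolding monom3_conv coeff3_def by auto

lemma graded_piece_add:
  "p \<in> graded_piece a b c d \<Longrightarrow> q \<in> graded_piece a b c d \<Longrightarrow> p + q \<in> graded_piece a b c d"
  for p q :: "'k::comm_ring_1 poly3"
  unfolding graded_piece_def by auto (metis add.right_neutral add.left_neutral)

lemma graded_piece_sum:
  "(\<And>x. x \<in> A \<Longrightarrow> f x \<in> graded_piece a b c d) \<Longrightarrow> sum f A \<in> graded_piece a b c d"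
  for f :: "'a \<Rightarrow> 'k::comm_ring_1 poly3"
  by (induction A rule: infinite_finite_induct) (auto simp: graded_piece_add, auto simp: graded_piece_def)

lemma graded_piece_mult:
  fixes p q :: "'k::comm_ring_1 poly3"
  assumes "p \<in> graded_piece a b c d" and "q \<in> graded_piece a b c e"
  shows "p * q \<in> graded_piece a b c (d + e)"
  unfolding graded_piece_def mem_Collect_eq
proof (intro allI impI)
  fix i j k
  assume "coeff3 (p * q) i j k \<noteq> 0"
  then obtain i' j' k' where le: "k' \<le> k" "j' \<le> j" "i' \<le> i"
    and "coeff3 p i' j' k' * coeff3 q (i - i') (j - j') (k - k') \<noteq> 0"
    unfolding coeff3_mult by (meson atMost_iff sum.not_neutral_contains_not_neutral)
  then have "coeff3 p i' j' k' \<noteq> 0" "coeff3 q (i - i') (j - j') (k - k') \<noteq> 0" by auto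
  then have "a * i' + b * j' + c * k' = d" "a * (i - i') + b * (j - j') + c * (k - k') = e"
    using assms unfolding graded_piece_def by blast+
  moreover obtain i'' j'' k'' where "i = i' + i''" "j = j' + j''" "k = k' + k''"
    using le by (metis le_Suc_ex)
  ultimately show "a * i + b * j + c * k = d + e" by (auto simp: algebra_simps)
qed

lemma graded_piece_const: "const3 (t :: 'k::comm_ring_1) \<in> graded_piece a b c 0"
  using coeff3_monom[of t 0 0 0]
  by (auto simp: graded_piece_def)

lemma graded_piece_vars:
  "(X :: 'k::comm_ring_1 poly3) \<in> graded_piece a b c a"
  "(Y :: 'k poly3) \<in> graded_piece a b c b" "(Z :: 'k poly3) \<in> graded_piece a b c c"
  using coeff3_monom[of "1::'k" 1 0 0] coeff3_monom[of "1::'k" 0 1 0] coeff3_monom[of "1::'k" 0 0 1]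
  by (auto simp: graded_piece_def split: if_splits)

lemma graded_piece_power:
  "p \<in> graded_piece a b c d \<Longrightarrow> p ^ n \<in> graded_piece a b c (d * n)"
  for p :: "'k::comm_ring_1 poly3"
proof (induction n)
  case 0
  then show ?case using graded_piece_const[of 1 a b c] by simp
next
  case (Suc n)
  then show ?case using graded_piece_mult[of p a b c d "p ^ n" "d * n"] by simp
qed

lemma finite_exponents:
  assumes "1 \<le> a" "1 \<le> b" "1 \<le> c"
  shows "finite {(i, j, k). a * i + b * j + c * k = (d::nat)}"
proof (rule finite_subset)
  show "{(i, j, k). a * i + b * j + c * k = d} \<subseteq> {..d} \<times> {..d} \<times> {..d}"
  proof (clarsimp, intro conjI)
    fix i j k
    have "i \<le> a * i" "j \<le> b * j" "k \<le> c * k" using assms by simp_all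
    then show "i \<le> a * i + b * j + c * k" "j \<le> a * i + b * j + c * k" "k \<le> a * i + b * j + c * k"
      by linarith+
  qed
qed auto

lemma graded_piece_expansion:
  fixes p :: "'k::comm_ring_1 poly3"
  assumes "1 \<le> a" "1 \<le> b" "1 \<le> c" and p: "p \<in> graded_piece a b c d"
  shows "p = (\<Sum>(i, j, k)\<in>{(i, j, k). a * i + b * j + c * k = d}.
    const3 (coeff3 p i j k) * X ^ i * Y ^ j * Z ^ k)" (is "p = sum ?f ?S")
proof (rule coeff3_eqI)
  fix i j k
  have "coeff3 (sum ?f ?S) i j k = (\<Sum>x\<in>?S. if x = (i, j, k) then coeff3 p i j k else 0)"
    unfolding coeff3_sum by (rule sum.cong) (auto simp: coeff3_monom split: if_splits)
  also have "\<dots> = coeff3 p i j k"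
    using finite_exponents[OF assms(1-3), of d] p by (auto simp: graded_piece_def)
  finally show "coeff3 p i j k = coeff3 (sum ?f ?S) i j k" ..
qed

section \<open>Graded automorphisms\<close>

lemma graded_piece_subst3:
  fixes p :: "'k::comm_ring_1 poly3"
  assumes "1 \<le> a" "1 \<le> b" "1 \<le> c"
    and "P \<in> graded_piece a b c a" "Q \<in> graded_piece a b c b" "R \<in> graded_piece a b c c"
    and p: "p \<in> graded_piece a b c d"
  shows "subst3 P Q R p \<in> graded_piece a b c d"
proof -
  let ?S = "{(i, j, k). a * i + b * j + c * k = d}"
  have sum: "subst3 P Q R (sum f A) = (\<Sum>x\<in>A. subst3 P Q R (f x))" for f :: "'b \<Rightarrow> _" and A
    using subst3_simps(3)[of P Q R 0] by (induction A rule: infinite_finite_induct) simp_all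
  have power: "subst3 P Q R (q ^ n) = subst3 P Q R q ^ n" for q n
    using subst3_simps(3)[of P Q R 1] by (induction n) simp_all
  have "subst3 P Q R p = (\<Sum>(i, j, k)\<in>?S. const3 (coeff3 p i j k) * P ^ i * Q ^ j * R ^ k)"
    by (subst graded_piece_expansion[OF assms(1-3) p])
      (auto simp: sum power intro!: sum.cong)
  also have "\<dots> \<in> graded_piece a b c d"
  proof (rule graded_piece_sum)
    fix x
    assume "x \<in> ?S"
    then obtain i j k where x: "x = (i, j, k)" and d: "a * i + b * j + c * k = d" by auto
    have "const3 (coeff3 p i j k) * P ^ i * Q ^ j * R ^ k
        \<in> graded_piece a b c (0 + a * i + b * j + c * k)"
      using assms by (intro graded_piece_mult graded_piece_power graded_piece_const)
    then show "(case x of (i, j, k) \<Rightarrow> const3 (coeff3 p i j k) * P ^ i * Q ^ j * R ^ k)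
        \<in> graded_piece a b c d"
      using x d by simp
  qed
  finally show ?thesis .
qed

text \<open>Surjectivity on each graded piece comes from the inverse preserving degrees as well,
  hence the second homogeneous triple \<open>P'\<close>, \<open>Q'\<close>,
  \<open>R'\<close>.\<close>

lemma graded_automorphism_subst3:
  fixes P Q R P' Q' R' :: "'k::field_char_0 poly3"
  assumes pos: "1 \<le> a" "1 \<le> b" "1 \<le> c"
    and gr: "P \<in> graded_piece a b c a" "Q \<in> graded_piece a b c b" "R \<in> graded_piece a b c c"
    and gr': "P' \<in> graded_piece a b c a" "Q' \<in> graded_piece a b c b" "R' \<in> graded_piece a b c c"
    and inv: "subst3 P Q R P' = X" "subst3 P Q R Q' = Y" "subst3 P Q R R' = Z"
    and inv': "subst3 P' Q' R' P = X" "subst3 P' Q' R' Q = Y" "subst3 P' Q' R' R = Z"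
  shows "graded_automorphism a b c (subst3 P Q R)"
proof -
  have 1: "subst3 P Q R (subst3 P' Q' R' p) = p" for p
    by (induction p rule: poly3_induct) (simp_all add: inv)
  have 2: "subst3 P' Q' R' (subst3 P Q R p) = p" for p
    by (induction p rule: poly3_induct) (simp_all add: inv')
  have "bij (subst3 P Q R)"
    by (rule o_bij[of "subst3 P' Q' R'"]) (auto simp: 1 2)
  moreover have "subst3 P Q R ` graded_piece a b c d = graded_piece a b c d" for d
  proof
    show "subst3 P Q R ` graded_piece a b c d \<subseteq> graded_piece a b c d"
      using graded_piece_subst3[OF pos gr] by blast
    show "graded_piece a b c d \<subseteq> subst3 P Q R ` graded_piece a b c d"
      using graded_piece_subst3[OF pos gr'] 1 by (metis image_eqI subsetI)
  qed
  ultimately show ?thesis by (simp add: graded_automorphism_def)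
qed

definition graded_equiv :: "nat \<Rightarrow> nat \<Rightarrow> nat \<Rightarrow> 'k::field poly3 \<Rightarrow> 'k poly3 \<Rightarrow> bool" where
  "graded_equiv a b c p q \<longleftrightarrow> (\<exists>\<phi>. graded_automorphism a b c \<phi> \<and> \<phi> p = q)"

lemma graded_equiv_subst3:
  fixes P Q R P' Q' R' :: "'k::field_char_0 poly3"
  assumes "1 \<le> a" "1 \<le> b" "1 \<le> c"
    and "P \<in> graded_piece a b c a" "Q \<in> graded_piece a b c b" "R \<in> graded_piece a b c c"
    and "P' \<in> graded_piece a b c a" "Q' \<in> graded_piece a b c b" "R' \<in> graded_piece a b c c"
    and "\<And>u v w. eval3 P' (eval3 P u v w) (eval3 Q u v w) (eval3 R u v w) = u"
    and "\<And>u v w. eval3 Q' (eval3 P u v w) (eval3 Q u v w) (eval3 R u v w) = v"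
    and "\<And>u v w. eval3 R' (eval3 P u v w) (eval3 Q u v w) (eval3 R u v w) = w"
    and "\<And>u v w. eval3 P (eval3 P' u v w) (eval3 Q' u v w) (eval3 R' u v w) = u"
    and "\<And>u v w. eval3 Q (eval3 P' u v w) (eval3 Q' u v w) (eval3 R' u v w) = v"
    and "\<And>u v w. eval3 R (eval3 P' u v w) (eval3 Q' u v w) (eval3 R' u v w) = w"
    and "\<And>u v w. eval3 q u v w = eval3 p (eval3 P u v w) (eval3 Q u v w) (eval3 R u v w)"
  shows "graded_equiv a b c p q"
  unfolding graded_equiv_def
proof (intro exI conjI)
  show "graded_automorphism a b c (subst3 P Q R)"
    by (rule graded_automorphism_subst3[of a b c P Q R P' Q' R'])
      (use assms(1-9) in \<open>auto intro!: poly3_eqI simp: assms(10-15)\<close>)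
  show "subst3 P Q R p = q"
    by (rule poly3_eqI) (simp add: assms)
qed

lemma graded_equiv_trans:
  assumes "graded_equiv a b c p q" and "graded_equiv a b c q r"
  shows "graded_equiv a b c p r"
proof -
  obtain \<phi> \<psi> where \<phi>: "graded_automorphism a b c \<phi>" "\<phi> p = q"
    and \<psi>: "graded_automorphism a b c \<psi>" "\<psi> q = r"
    using assms unfolding graded_equiv_def by blast
  have "(\<psi> \<circ> \<phi>) ` graded_piece a b c d = graded_piece a b c d" for d
    using \<phi>(1) \<psi>(1) unfolding graded_automorphism_def by (metis image_comp)
  then have "graded_automorphism a b c (\<psi> \<circ> \<phi>)"
    using \<phi>(1) \<psi>(1) unfolding graded_automorphism_def by (simp add: bij_comp)
  then show ?thesis using \<phi> \<psi> unfolding graded_equiv_def by auto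
qed

lemma graded_automorphism_inv:
  assumes "graded_automorphism a b c \<phi>"
  shows "graded_automorphism a b c (inv \<phi>)"
proof -
  have \<phi>: "bij \<phi>" "\<And>p q. \<phi> (p + q) = \<phi> p + \<phi> q" "\<And>p q. \<phi> (p * q) = \<phi> p * \<phi> q"
    "\<And>t. \<phi> (const3 t) = const3 t" "\<And>d. \<phi> ` graded_piece a b c d = graded_piece a b c d"
    using assms unfolding graded_automorphism_def by blast+
  let ?\<psi> = "inv \<phi>"
  have inv: "\<phi> (?\<psi> x) = x" "?\<psi> (\<phi> x) = x" for x
    using \<phi>(1) by (simp_all add: bij_is_surj surj_f_inv_f bij_is_inj)
  show ?thesis
    unfolding graded_automorphism_def
  proof (intro conjI allI)
    show "bij ?\<psi>" using \<phi>(1) by (rule bij_imp_bij_inv)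
    show "?\<psi> (x + y) = ?\<psi> x + ?\<psi> y" "?\<psi> (x * y) = ?\<psi> x * ?\<psi> y" for x y
      using inv \<phi>(2,3) by metis+
    show "?\<psi> (const3 t) = const3 t" for t using inv \<phi>(4) by metis
    show "?\<psi> ` graded_piece a b c d = graded_piece a b c d" for d
      using \<phi>(5)[of d] by (metis bij_is_inj[OF \<phi>(1)] image_inv_f_f)
  qed
qed

section \<open>Invariance of isolated singularities\<close>

lemma eval3_zero_graded:
  assumes "p \<in> graded_piece a b c d" and "0 < d"
  shows "eval3 p 0 0 0 = (0 :: 'k::comm_ring_1)"
proof -
  have "coeff3 p 0 0 0 = 0" using assms unfolding graded_piece_def by force
  then show ?thesis by (simp add: eval3_def coeff3_def poly_0_coeff_0 flip: poly_0_coeff_0)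
qed

lemma isolated_singularity_image:
  fixes p :: "'k::field_char_0 poly3"
  assumes pos: "1 \<le> a" "1 \<le> b" "1 \<le> c"
    and aut: "graded_automorphism a b c \<phi>" and iso: "isolated_singularity p"
  shows "isolated_singularity (\<phi> p)"
proof -
  define \<psi> where "\<psi> = inv \<phi>"
  have \<phi>: "\<And>p q. \<phi> (p + q) = \<phi> p + \<phi> q" "\<And>p q. \<phi> (p * q) = \<phi> p * \<phi> q"
    "\<And>t. \<phi> (const3 t) = const3 t" and bij: "bij \<phi>"
    using aut unfolding graded_automorphism_def by blast+
  have \<psi>: "\<And>p q. \<psi> (p + q) = \<psi> p + \<psi> q" "\<And>p q. \<psi> (p * q) = \<psi> p * \<psi> q"
    "\<And>t. \<psi> (const3 t) = const3 t" "\<And>d. \<psi> ` graded_piece a b c d = graded_piece a b c d"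
    using graded_automorphism_inv[OF aut] unfolding graded_automorphism_def \<psi>_def by blast+
  have inv: "\<phi> (\<psi> r) = r" "\<psi> (\<phi> r) = r" for r
    using bij by (simp_all add: \<psi>_def bij_is_surj surj_f_inv_f bij_is_inj)
  show ?thesis
    unfolding isolated_singularity_def
  proof (intro allI impI, elim conjE)
    fix u v w
    assume 0: "eval3 (dX (\<phi> p)) u v w = 0" "eval3 (dY (\<phi> p)) u v w = 0" "eval3 (dZ (\<phi> p)) u v w = 0"
    let ?u = "eval3 (\<phi> X) u v w" and ?v = "eval3 (\<phi> Y) u v w" and ?w = "eval3 (\<phi> Z) u v w"
    have ev: "eval3 (\<psi> r) ?u ?v ?w = eval3 r u v w" for r
      using eval3_hom[of \<phi> "\<psi> r" u v w] \<phi> inv by simp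
    \<comment> \<open>The chain rule is applied to the inverse, in
      \<open>p = \<psi> (\<phi> p)\<close>, at the image point: there \<open>\<psi>\<close> of a
      partial of \<open>\<phi> p\<close> has the value of that partial at the original point, which
      is 0. So no Jacobian has to be inverted.\<close>
    have "eval3 (D p) ?u ?v ?w = 0"
      if "\<And>p q. D (p + q) = D p + D q" "\<And>p q. D (p * q) = p * D q + q * D p" "\<And>t. D (const3 t) = 0"
      for D :: "'k poly3 \<Rightarrow> 'k poly3"
      using chain_rule[of \<psi> D "\<phi> p"] \<psi>(1-3) that by (simp add: inv ev 0)
    then have "eval3 (dX p) ?u ?v ?w = 0" "eval3 (dY p) ?u ?v ?w = 0" "eval3 (dZ p) ?u ?v ?w = 0"
      by simp_all
    then have "?u = 0 \<and> ?v = 0 \<and> ?w = 0"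
      using iso unfolding isolated_singularity_def by blast
    then have *: "eval3 r u v w = eval3 (\<psi> r) 0 0 0" for r using ev[of r] by simp
    have "\<psi> X \<in> graded_piece a b c a" "\<psi> Y \<in> graded_piece a b c b" "\<psi> Z \<in> graded_piece a b c c"
      using \<psi>(4) graded_piece_vars by blast+
    then have "eval3 (\<psi> X) 0 0 0 = 0" "eval3 (\<psi> Y) 0 0 0 = 0" "eval3 (\<psi> Z) 0 0 0 = 0"
      using pos by (auto intro: eval3_zero_graded)
    then show "u = 0 \<and> v = 0 \<and> w = 0"
      using *[of X] *[of Y] *[of Z] by simp
  qed
qed

lemma isolated_singularity_equiv:
  fixes p q :: "'k::field_char_0 poly3"
  assumes "1 \<le> a" "1 \<le> b" "1 \<le> c" and "graded_equiv a b c p q" and "isolated_singularity p"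
  shows "isolated_singularity q"
  using assms isolated_singularity_image unfolding graded_equiv_def by blast

lemma isolated_singularity_image_iff:
  fixes p :: "'k::field_char_0 poly3"
  assumes "1 \<le> a" "1 \<le> b" "1 \<le> c" and "graded_automorphism a b c \<phi>"
  shows "isolated_singularity (\<phi> p) \<longleftrightarrow> isolated_singularity p"
  using isolated_singularity_image[OF assms]
    isolated_singularity_image[OF assms(1-3) graded_automorphism_inv[OF assms(4)], of "\<phi> p"] assms(4) by (auto simp: graded_automorphism_def bij_is_inj)

lemma isolated_singularityD:
  assumes "isolated_singularity p"
    and "eval3 (dX p) u v w = 0" and "eval3 (dY p) u v w = 0" and "eval3 (dZ p) u v w = 0"
  shows "u = 0 \<and> v = 0 \<and> w = 0"
  using assms unfolding isolated_singularity_def by blast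

section \<open>The normal forms\<close>

lemma isolated_singularity_hesse_iff:
  fixes l :: "'k::field_char_0"
  shows "isolated_singularity (X ^ 3 + Y ^ 3 + Z ^ 3 + const3 l * X * Y * Z) \<longleftrightarrow> (- l) ^ 3 \<noteq> 27"
    (is "isolated_singularity ?p \<longleftrightarrow> _")
proof
  assume iso: "isolated_singularity ?p"
  show "(- l) ^ 3 \<noteq> 27"
  proof
    assume l: "(- l) ^ 3 = 27"
    then have "l \<noteq> 0" by auto
    moreover have "l * l ^ 2 = - ((- l) ^ 3)"
      by (simp add: power3_eq_cube power2_eq_square)
    with l have "l * l ^ 2 = - 27" by simp
    ultimately show False
      \<comment> \<open>With \<open>u = v = 1\<close> the first two partials vanish for
        \<open>w = - 3 / l\<close>; the third is then \<open>27 / l^2 + l\<close>.\<close>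
      using isolated_singularityD[OF iso, of 1 1 "- 3 / l"]
      by (simp add: field_simps)
  qed
next
  assume l: "(- l) ^ 3 \<noteq> 27"
  show "isolated_singularity ?p"
    unfolding isolated_singularity_def
  proof (intro allI impI, elim conjE)
    fix u v w
    assume "eval3 (dX ?p) u v w = 0" "eval3 (dY ?p) u v w = 0" "eval3 (dZ ?p) u v w = 0"
    then have e: "3 * u ^ 2 + l * v * w = 0" "3 * v ^ 2 + l * u * w = 0" "3 * w ^ 2 + l * u * v = 0"
      by (simp_all add: algebra_simps)
    \<comment> \<open>The product of the three equations, with the \<open>l\<close>-terms moved to
      the right.\<close>
    then have "27 * (u * v * w) ^ 2 = (- l) ^ 3 * (u * v * w) ^ 2"
      by algebra
    then have "(u * v * w) ^ 2 = 0" using l by (metis mult_right_cancel)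
    then have "u * v * w = 0" by simp
    moreover have "3 * u ^ 3 = - l * (u * v * w)" "3 * v ^ 3 = - l * (u * v * w)" "3 * w ^ 3 = - l * (u * v * w)"
      using e by - (algebra+)
    ultimately have "3 * u ^ 3 = 0" "3 * v ^ 3 = 0" "3 * w ^ 3 = 0" by (simp_all only: mult_zero_right)
    then show "u = 0 \<and> v = 0 \<and> w = 0" by simp
  qed
qed

lemma isolated_singularity_112_iff:
  fixes l :: "'k::{alg_closed_field, field_char_0}"
  shows "isolated_singularity (X ^ 4 + Y ^ 4 + Z ^ 2 + const3 l * X * Y * Z) \<longleftrightarrow> (- l) ^ 4 \<noteq> 64"
    (is "isolated_singularity ?p \<longleftrightarrow> _")
proof
  assume iso: "isolated_singularity ?p"
  show "(- l) ^ 4 \<noteq> 64"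
  proof
    assume l: "(- l) ^ 4 = 64"
    \<comment> \<open>On \<open>v = 1\<close> the \<open>z\<close>-partial gives
      \<open>w = - l x / 2\<close>, and the \<open>y\<close>-partial then gives
      \<open>l^2 x^2 = 8\<close>, which for \<open>l^4 = 64\<close> means
      \<open>x^2 = l^2 / 8\<close>.\<close>
    obtain x where x: "x ^ 2 = l ^ 2 / 8"
      using nth_root_exists[of 2 "l ^ 2 / 8"] by auto
    have "l ^ 4 = 64" using l by simp
    moreover have "8 * x ^ 2 = l ^ 2" using x by (simp add: mult.commute)
    moreover have "8 * x ^ 3 = 8 * x ^ 2 * x" "8 * (l ^ 2 * x ^ 2) = l ^ 2 * (8 * x ^ 2)" "l ^ 2 * l ^ 2 = l ^ 4"
      by (simp_all add: power3_eq_cube power2_eq_square numeral_eq_Suc)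
    ultimately have "8 * x ^ 3 = l ^ 2 * x" "l ^ 2 * x ^ 2 = 8"
      by simp_all
    then show False
      using isolated_singularityD[OF iso, of x 1 "- l * x / 2"]
      by (simp add: field_simps power2_eq_square)
  qed
next
  assume l: "(- l) ^ 4 \<noteq> 64"
  show "isolated_singularity ?p"
    unfolding isolated_singularity_def
  proof (intro allI impI, elim conjE)
    fix u v w
    assume "eval3 (dX ?p) u v w = 0" "eval3 (dY ?p) u v w = 0" "eval3 (dZ ?p) u v w = 0"
    then have e: "4 * u ^ 3 + l * v * w = 0" "4 * v ^ 3 + l * u * w = 0" "2 * w = - l * u * v"
      by (simp_all add: algebra_simps eq_neg_iff_add_eq_0)
    then have "8 * u ^ 3 = l ^ 2 * v ^ 2 * u" "8 * v ^ 3 = l ^ 2 * u ^ 2 * v" by - (algebra+)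
    moreover from this have "64 * u ^ 5 = l ^ 4 * u ^ 5" by algebra
    ultimately show "u = 0 \<and> v = 0 \<and> w = 0" using l e by auto
  qed
qed

lemma isolated_singularity_123_iff:
  fixes l :: "'k::field_char_0"
  shows "isolated_singularity (X ^ 6 + Y ^ 3 + Z ^ 2 + const3 l * X * Y * Z) \<longleftrightarrow> (- l) ^ 6 \<noteq> 432"
    (is "isolated_singularity ?p \<longleftrightarrow> _")
proof
  assume iso: "isolated_singularity ?p"
  show "(- l) ^ 6 \<noteq> 432"
  proof
    assume l: "(- l) ^ 6 = 432"
    have "l ^ 6 = 432" using l by simp
    then show False
      \<comment> \<open>On \<open>u = 1\<close> the \<open>y\<close>- and \<open>z\<close>-partials
        determine this point, apart from \<open>v = 0\<close>; the \<open>x\<close>-partial there is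
        \<open>6 - l^6 / 72\<close>.\<close>
      using isolated_singularityD[OF iso, of 1 "l ^ 2 / 6" "- (l ^ 3) / 12"]
      by (simp add: field_simps flip: power_add power_Suc)
  qed
next
  assume l: "(- l) ^ 6 \<noteq> 432"
  show "isolated_singularity ?p"
    unfolding isolated_singularity_def
  proof (intro allI impI, elim conjE)
    fix u v w
    assume "eval3 (dX ?p) u v w = 0" "eval3 (dY ?p) u v w = 0" "eval3 (dZ ?p) u v w = 0"
    then have e: "6 * u ^ 5 + l * v * w = 0" "3 * v ^ 2 + l * u * w = 0" "2 * w = - l * u * v"
      by (simp_all add: algebra_simps eq_neg_iff_add_eq_0)
    then have "v * (6 * v - l ^ 2 * u ^ 2) = 0" by algebra
    moreover have "12 * u ^ 5 = l ^ 2 * u * v ^ 2" using e by algebra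
    moreover from this have "432 * u ^ 5 = l ^ 6 * u ^ 5" if "6 * v = l ^ 2 * u ^ 2"
      using that by algebra
    ultimately show "u = 0 \<and> v = 0 \<and> w = 0" using l e by auto
  qed
qed

lemma quadratic_root:
  fixes p q r :: "'k::alg_closed_field"
  assumes "p \<noteq> 0"
  obtains x where "p * x ^ 2 + q * x + r = 0"
proof -
  have "degree [:r, q, p:] > 0" using assms by simp
  then obtain x where "poly [:r, q, p:] x = 0" using alg_closed_imp_poly_has_root by blast
  then show thesis using that[of x] by (simp add: algebra_simps power2_eq_square)
qed

lemma quadratic_form_root:
  fixes p q r :: "'k::alg_closed_field"
  obtains x y where "p * x ^ 2 + q * x * y + r * y ^ 2 = 0" and "x \<noteq> 0 \<or> y \<noteq> 0"
proof (cases "p = 0")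
  case True
  then show thesis using that[of 1 0] by simp
next
  case False
  then obtain x where "p * x ^ 2 + q * x + r = 0" by (rule quadratic_root)
  then show thesis using that[of x 1] by simp
qed

section \<open>Admissible weights\<close>

text \<open>For exponent 0 the truncated \<open>i - 1\<close> is harmless because of the factor
  \<open>of_nat i\<close>.\<close>

lemma eval3_partials:
  fixes p :: "'k::field poly3"
  assumes "1 \<le> a" "1 \<le> b" "1 \<le> c" and p: "p \<in> graded_piece a b c d"
  defines "S \<equiv> {(i, j, k). a * i + b * j + c * k = d}"
  shows "eval3 (dX p) u v w = (\<Sum>(i, j, k)\<in>S. coeff3 p i j k * (of_nat i * u ^ (i - 1)) * v ^ j * w ^ k)"
    and "eval3 (dY p) u v w = (\<Sum>(i, j, k)\<in>S. coeff3 p i j k * u ^ i * (of_nat j * v ^ (j - 1)) * w ^ k)"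
    and "eval3 (dZ p) u v w = (\<Sum>(i, j, k)\<in>S. coeff3 p i j k * u ^ i * v ^ j * (of_nat k * w ^ (k - 1)))"
proof -
  note exp = graded_piece_expansion[OF assms(1-4), folded S_def]
  have *: "eval3 (D p) u v w = (\<Sum>(i, j, k)\<in>S. eval3 (D (const3 (coeff3 p i j k) * X ^ i * Y ^ j * Z ^ k)) u v w)"
    if D: "\<And>p q. D (p + q) = D p + D q" for D :: "'k poly3 \<Rightarrow> 'k poly3"
  proof -
    have "D 0 = 0" using D[of 0 0] by (metis add.right_neutral add_left_cancel)
    have "D p = (\<Sum>(i, j, k)\<in>S. D (const3 (coeff3 p i j k) * X ^ i * Y ^ j * Z ^ k))"
      by (subst exp) (simp add: derivation_sum[of D, OF D \<open>D 0 = 0\<close>] case_prod_unfold)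
    then show ?thesis by (simp add: eval3_sum case_prod_unfold)
  qed
  show "eval3 (dX p) u v w = (\<Sum>(i, j, k)\<in>S. coeff3 p i j k * (of_nat i * u ^ (i - 1)) * v ^ j * w ^ k)"
    by (subst *) (auto intro!: sum.cong simp: algebra_simps)
  show "eval3 (dY p) u v w = (\<Sum>(i, j, k)\<in>S. coeff3 p i j k * u ^ i * (of_nat j * v ^ (j - 1)) * w ^ k)"
    by (subst *) (auto intro!: sum.cong simp: algebra_simps)
  show "eval3 (dZ p) u v w = (\<Sum>(i, j, k)\<in>S. coeff3 p i j k * u ^ i * v ^ j * (of_nat k * w ^ (k - 1)))"
    by (subst *) (auto intro!: sum.cong simp: algebra_simps)
qed

text \<open>At \<open>(0, 0, 1)\<close> the partials see only monomials of total degree at most one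
  in \<open>x\<close> and \<open>y\<close>; without any such monomial the point would be
  singular.\<close>

lemma monomial_near_z_axis:
  fixes p :: "'k::field poly3"
  assumes "1 \<le> a" "1 \<le> b" "1 \<le> c" "p \<in> graded_piece a b c d" and iso: "isolated_singularity p"
  shows "\<exists>i j k. a * i + b * j + c * k = d \<and> i + j \<le> 1"
proof (rule ccontr)
  assume "\<not> ?thesis"
  then have no: "\<not> i + j \<le> 1" if "a * i + b * j + c * k = d" for i j k
    using that by blast
  have "eval3 (dX p) 0 0 1 = 0" "eval3 (dY p) 0 0 1 = 0" "eval3 (dZ p) 0 0 1 = 0"
    unfolding eval3_partials[OF assms(1-4)] using no
    by (fastforce intro!: sum.neutral simp: power_0_left split: if_splits)+
  from isolated_singularityD[OF iso this] show False by simp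
qed

lemma monomial_near_y_axis:
  fixes p :: "'k::field poly3"
  assumes "1 \<le> a" "1 \<le> b" "1 \<le> c" "p \<in> graded_piece a b c d" and iso: "isolated_singularity p"
  shows "\<exists>i j k. a * i + b * j + c * k = d \<and> i + k \<le> 1"
proof (rule ccontr)
  assume "\<not> ?thesis"
  then have no: "\<not> i + k \<le> 1" if "a * i + b * j + c * k = d" for i j k
    using that by blast
  have "eval3 (dX p) 0 1 0 = 0" "eval3 (dY p) 0 1 0 = 0" "eval3 (dZ p) 0 1 0 = 0"
    unfolding eval3_partials[OF assms(1-4)] using no
    by (fastforce intro!: sum.neutral simp: power_0_left split: if_splits)+
  from isolated_singularityD[OF iso this] show False by simp
qed

text \<open>
  Every monomial of degree \<open>a + 2 b\<close> contains \<open>x\<close>, so the polynomial is \<open>x\<close> times some \<open>q\<close>, and it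
  is singular at the zeros of \<open>q\<close> on the line \<open>x = 0\<close>, where \<open>q\<close> is a quadratic form in \<open>y\<close> and \<open>z\<close>.
\<close>

lemma not_isolated_abb:
  fixes p :: "'k::alg_closed_field poly3"
  assumes "1 \<le> a" "a < b" and p: "p \<in> graded_piece a b b (a + b + b)"
  shows "\<not> isolated_singularity p"
proof
  assume iso: "isolated_singularity p"
  let ?S = "{(i, j, k). a * i + b * j + b * k = a + b + b}"
  have pos: "1 \<le> a" "1 \<le> b" "1 \<le> b" using assms by simp_all
  have i: "1 \<le> i \<and> (i = 1 \<longrightarrow> j + k = 2)" if "a * i + b * j + b * k = a + b + b" for i j k
  proof -
    have eq: "a * i + b * (j + k) = a + b * 2" using that by (simp add: algebra_simps)
    \<comment> \<open>Otherwise \<open>a + 2 b\<close> would be a multiple of \<open>b\<close>, but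
      it lies strictly between \<open>2 b\<close> and \<open>3 b\<close>.\<close>
    have "i \<noteq> 0"
    proof
      assume "i = 0"
      then have "b * 2 < b * (j + k)" "b * (j + k) < b * 3" using eq assms by simp_all
      then show False by simp
    qed
    then show ?thesis using eq assms by auto
  qed
  obtain v w where vw: "coeff3 p 1 2 0 * v ^ 2 + coeff3 p 1 1 1 * v * w + coeff3 p 1 0 2 * w ^ 2 = 0"
    and nz: "v \<noteq> 0 \<or> w \<noteq> 0"
    using quadratic_form_root by blast
  have zero: "(\<Sum>(i, j, k)\<in>?S. f i j k * 0 ^ i * g i j k * h i j k) = 0" for f g h :: "nat \<Rightarrow> nat \<Rightarrow> nat \<Rightarrow> 'k"
  proof (intro sum.neutral ballI)
    fix x
    assume "x \<in> ?S"
    then obtain i j k where x: "x = (i, j, k)" and eq: "a * i + b * j + b * k = a + b + b" by blast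
    have "i \<noteq> 0" using i[OF eq] by simp
    then show "(case x of (i, j, k) \<Rightarrow> f i j k * 0 ^ i * g i j k * h i j k) = 0"
      using x by simp
  qed
  have "eval3 (dY p) 0 v w = 0" "eval3 (dZ p) 0 v w = 0"
    unfolding eval3_partials[OF pos p]
    using zero[of "coeff3 p" "\<lambda>i j k. of_nat j * v ^ (j - 1)" "\<lambda>i j k. w ^ k"]
      zero[of "coeff3 p" "\<lambda>i j k. v ^ j" "\<lambda>i j k. of_nat k * w ^ (k - 1)"] by - (assumption+)
  moreover have "eval3 (dX p) 0 v w = 0"
  proof -
    \<comment> \<open>At \<open>x = 0\<close> only monomials linear in \<open>x\<close> survive, and
      these carry the three coefficients of the quadratic form whose zero was chosen.\<close>
    have "eval3 (dX p) 0 v w =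
        (\<Sum>(i, j, k)\<in>{(1, 2, 0), (1, 1, 1), (1, 0, 2)}. coeff3 p i j k * (of_nat i * 0 ^ (i - 1)) * v ^ j * w ^ k)"
      unfolding eval3_partials[OF pos p]
    proof (rule sum.mono_neutral_right)
      show "finite ?S" using finite_exponents[OF pos] .
      show "\<forall>x\<in>?S - {(1, 2, 0), (1, 1, 1), (1, 0, 2)}.
        (case x of (i, j, k) \<Rightarrow> coeff3 p i j k * (of_nat i * 0 ^ (i - 1)) * v ^ j * w ^ k) = 0"
      proof
        fix x
        assume "x \<in> ?S - {(1, 2, 0), (1, 1, 1), (1, 0, 2)}"
        then obtain i j k where x: "x = (i, j, k)" and eq: "a * i + b * j + b * k = a + b + b"
          and ni: "(i, j, k) \<notin> {(1, 2, 0), (1, 1, 1), (1, 0, 2)}" by blast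
        have "i \<noteq> 1"
        proof
          assume "i = 1"
          with i[OF eq] have "j + k = 2" by simp
          with ni \<open>i = 1\<close> show False by simp presburger
        qed
        with i[OF eq] have "i - 1 \<noteq> 0" by simp
        then show "(case x of (i, j, k) \<Rightarrow> coeff3 p i j k * (of_nat i * 0 ^ (i - 1)) * v ^ j * w ^ k) = 0"
          using x by simp
      qed
    qed auto
    then show ?thesis using vw by (simp add: add.assoc)
  qed
  ultimately show False
    using isolated_singularityD[OF iso] nz by blast
qed

lemma admissible_weights:
  fixes p :: "'k::alg_closed_field poly3"
  assumes "1 \<le> a" "a \<le> b" "b \<le> c" and gcd: "gcd a (gcd b c) = 1"
    and p: "p \<in> graded_piece a b c (a + b + c)" and iso: "isolated_singularity p"
  shows "(a, b, c) \<in> {(1, 1, 1), (1, 1, 2), (1, 2, 3)}"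
proof -
  have pos: "1 \<le> a" "1 \<le> b" "1 \<le> c" using assms by simp_all
  have c: "c = a + b \<or> b = c"
  proof -
    obtain i j k where eq: "a * i + b * j + c * k = a + b + c" and "i + j \<le> 1"
      using monomial_near_z_axis[OF pos p iso] by blast
    then consider "c * k = a + b + c" | "c * k = b + c" | "c * k = a + c"
      by (cases i; cases j) auto
    \<comment> \<open>\<open>k < 2\<close> is too small, \<open>k = 2\<close> gives
      \<open>c = a + b\<close>, \<open>c = b\<close> or \<open>c = a\<close>, and
      \<open>k \<ge> 3\<close> is possible only for \<open>a = b = c\<close>.\<close>
    moreover have "k < 2 \<or> k = 2 \<or> 3 \<le> k" by auto
    moreover have "c * k \<le> c" if "k < 2" using that by (cases k) auto
    moreover have "c * 3 \<le> c * k" if "3 \<le> k" using that by simp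
    ultimately show ?thesis using assms(1-3) by cases auto
  qed
  show ?thesis
  proof (cases "b = c")
    case True
    then have "a = b" using not_isolated_abb[of a b p] p iso assms by (metis le_neq_implies_less)
    then show ?thesis using True gcd by simp
  next
    case False
    then have c: "c = a + b" using c by simp
    obtain i j k where eq: "a * i + b * j + c * k = a + b + c" and "i + k \<le> 1"
      using monomial_near_y_axis[OF pos p iso] by blast
    then consider "b * j = 2 * a + 2 * b" | "b * j = a + 2 * b" | "b * j = a + b"
      using c by (cases i; cases k) auto
    then have "b dvd 2 * a"
    proof cases
      case 1
      then have "b dvd 2 * a + 2 * b" by (metis dvd_triv_left)
      then show ?thesis by (simp add: dvd_add_left_iff)
    next
      case 2
      then have "b dvd a + 2 * b" by (metis dvd_triv_left)
      then show ?thesis by (simp add: dvd_add_left_iff)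
    next
      case 3
      then have "b dvd a + b" by (metis dvd_triv_left)
      then show ?thesis by (simp add: dvd_add_left_iff)
    qed
    \<comment> \<open>As \<open>1 \<le> a \<le> b\<close>, the quotient is 1 or 2. The weights are
      \<open>(a, 2 a, 3 a)\<close> or \<open>(a, a, 2 a)\<close>, and coprimality gives
      \<open>a = 1\<close>.\<close>
    then obtain m where m: "2 * a = b * m" by blast
    have "m \<noteq> 0" using m pos by (metis le_numeral_extra(2) mult_0_right mult_eq_0_iff zero_neq_numeral)
    moreover have "m \<le> 2"
    proof (rule ccontr)
      assume "\<not> m \<le> 2"
      then have "b * 3 \<le> b * m" by simp
      with m assms show False by linarith
    qed
    ultimately have "m = 1 \<or> m = 2" by auto
    then have "b = 2 * a \<or> b = a" using m by auto
    then show ?thesis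
    proof
      assume "b = 2 * a"
      then have "b = a * 2" "c = a * 3" using c by simp_all
      then show ?thesis using gcd by (simp add: gcd_nat.absorb1)
    next
      assume "b = a"
      then have "b = a" "c = a * 2" using c by simp_all
      then show ?thesis using gcd by (simp add: gcd_nat.absorb1)
    qed
  qed
qed

section \<open>Elementary automorphisms\<close>

lemma graded_piece_multI:
  "p \<in> graded_piece a b c d \<Longrightarrow> q \<in> graded_piece a b c e \<Longrightarrow> n = d + e \<Longrightarrow> p * q \<in> graded_piece a b c n"
  for p q :: "'k::comm_ring_1 poly3"
  using graded_piece_mult by blast

lemma graded_piece_const_mult:
  "p \<in> graded_piece a b c d \<Longrightarrow> const3 t * p \<in> graded_piece a b c d"
  for t :: "'k::comm_ring_1"
  by (rule graded_piece_multI[OF graded_piece_const]) simp_all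

lemma graded_equiv_scale:
  fixes p q :: "'k::field_char_0 poly3"
  assumes "1 \<le> a" "1 \<le> b" "1 \<le> c" and "r \<noteq> 0" "s \<noteq> 0" "t \<noteq> 0"
    and "\<And>u v w. eval3 q u v w = eval3 p (r * u) (s * v) (t * w)"
  shows "graded_equiv a b c p q"
  by (rule graded_equiv_subst3[of a b c "const3 r * X" "const3 s * Y" "const3 t * Z"
        "const3 (1 / r) * X" "const3 (1 / s) * Y" "const3 (1 / t) * Z"])
    (use assms(1-6) in \<open>auto intro!: graded_piece_const_mult graded_piece_vars simp: assms(7)\<close>)

text \<open>Since the shift depends on \<open>u\<close> and \<open>v\<close> only, the inverse is
  the shear by its negative.\<close>

lemma graded_equiv_shear_z:
  fixes p q s :: "'k::field_char_0 poly3"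
  assumes "1 \<le> a" "1 \<le> b" "1 \<le> c"
    and s: "s \<in> graded_piece a b c c" and no_z: "\<And>u v w. eval3 s u v w = f u v"
    and "\<And>u v w. eval3 q u v w = eval3 p u v (w + f u v)"
  shows "graded_equiv a b c p q"
proof (rule graded_equiv_subst3[of a b c X Y "Z + s" X Y "Z + const3 (- 1) * s"])
  show "Z + s \<in> graded_piece a b c c"
    by (intro graded_piece_add graded_piece_vars s)
  show "Z + const3 (- 1) * s \<in> graded_piece a b c c"
    by (intro graded_piece_add graded_piece_const_mult graded_piece_vars s)
qed (use assms(1-3) in \<open>auto intro!: graded_piece_vars simp: no_z assms(6)\<close>)

lemma graded_equiv_shear_y:
  fixes p q s :: "'k::field_char_0 poly3"
  assumes "1 \<le> a" "1 \<le> b" "1 \<le> c"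
    and s: "s \<in> graded_piece a b c b" and no_y: "\<And>u v w. eval3 s u v w = f u w"
    and "\<And>u v w. eval3 q u v w = eval3 p u (v + f u w) w"
  shows "graded_equiv a b c p q"
proof (rule graded_equiv_subst3[of a b c X "Y + s" Z X "Y + const3 (- 1) * s" Z])
  show "Y + s \<in> graded_piece a b c b"
    by (intro graded_piece_add graded_piece_vars s)
  show "Y + const3 (- 1) * s \<in> graded_piece a b c b"
    by (intro graded_piece_add graded_piece_const_mult graded_piece_vars s)
qed (use assms(1-3) in \<open>auto intro!: graded_piece_vars simp: no_y assms(6)\<close>)

lemma nth_root_nonzero:
  fixes x :: "'k::alg_closed_field"
  assumes "0 < n" "x \<noteq> 0"
  obtains y where "y ^ n = x" "y \<noteq> 0"
  using nth_root_exists[OF assms(1), of x] assms by (metis zero_power)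

section \<open>Weights \<open>(1, 2, 3)\<close>\<close>

lemma expansion_123:
  fixes p :: "'k::comm_ring_1 poly3"
  assumes "p \<in> graded_piece 1 2 3 6"
  obtains c1 c2 c3 c4 c5 c6 c7 where
    "p = const3 c1 * Z ^ 2 + const3 c2 * X * Y * Z + const3 c3 * X ^ 3 * Z + const3 c4 * Y ^ 3
       + const3 c5 * X ^ 2 * Y ^ 2 + const3 c6 * X ^ 4 * Y + const3 c7 * X ^ 6"
proof -
  have S: "{(i, j, k). 1 * i + 2 * j + 3 * k = (6::nat)} =
      {(0, 0, 2), (1, 1, 1), (3, 0, 1), (0, 3, 0), (2, 2, 0), (4, 1, 0), (6, 0, 0)}"
    (is "?L = ?R")
  proof
    show "?L \<subseteq> ?R"
    proof
      fix x
      assume "x \<in> ?L"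
      then obtain i j k where x: "x = (i, j, k)" and eq: "i + 2 * j + 3 * k = 6" by auto
      then have "k \<le> 2" "j \<le> 3" by simp_all
      then have "k = 0 \<or> k = 1 \<or> k = 2" "j = 0 \<or> j = 1 \<or> j = 2 \<or> j = 3" by linarith+
      moreover have "i = 6 - 2 * j - 3 * k" using eq by simp
      ultimately show "x \<in> ?R" using eq x by (elim disjE) simp_all
    qed
  qed auto
  obtain f where "p = (\<Sum>(i, j, k)\<in>{(0, 0, 2), (1, 1, 1), (3, 0, 1), (0, 3, 0), (2, 2, 0), (4, 1, 0), (6, 0, 0)}.
      const3 (f i j k) * X ^ i * Y ^ j * Z ^ k)"
    using graded_piece_expansion[OF order.refl one_le_numeral one_le_numeral assms, unfolded S] by blast
  then show thesis
    by (intro that[of "f 0 0 2" "f 1 1 1" "f 3 0 1" "f 0 3 0"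
          "f 2 2 0" "f 4 1 0" "f 6 0 0"]) (simp add: algebra_simps)
qed

lemma classify_123:
  fixes p :: "'k::{alg_closed_field, field_char_0} poly3"
  assumes gr: "p \<in> graded_piece 1 2 3 6" and iso: "isolated_singularity p"
  obtains l where "graded_equiv 1 2 3 p (X ^ 6 + Y ^ 3 + Z ^ 2 + const3 l * X * Y * Z)"
proof -
  obtain c1 c2 c3 c4 c5 c6 c7 where p:
    "p = const3 c1 * Z ^ 2 + const3 c2 * X * Y * Z + const3 c3 * X ^ 3 * Z + const3 c4 * Y ^ 3
       + const3 c5 * X ^ 2 * Y ^ 2 + const3 c6 * X ^ 4 * Y + const3 c7 * X ^ 6"
    using expansion_123[OF gr] .
  \<comment> \<open>In degree 6 the monomials \<open>z^2\<close> and \<open>y^3\<close> are the only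
    ones that contribute to a partial at \<open>(0, 0, 1)\<close> and \<open>(0, 1, 0)\<close>
    respectively.\<close>
  have "c1 \<noteq> 0" using isolated_singularityD[OF iso, of 0 0 1] by (auto simp: p)
  have "c4 \<noteq> 0" using isolated_singularityD[OF iso, of 0 1 0] by (auto simp: p)
  obtain r where r: "r ^ 2 = 1 / c1" "r \<noteq> 0"
    using nth_root_nonzero[of 2 "1 / c1"] \<open>c1 \<noteq> 0\<close> by auto
  obtain s where s: "s ^ 3 = 1 / c4" "s \<noteq> 0"
    using nth_root_nonzero[of 3 "1 / c4"] \<open>c4 \<noteq> 0\<close> by auto
  define d2 d3 d5 d6 where "d2 = c2 * s * r" and "d3 = c3 * r" and "d5 = c5 * s ^ 2" and "d6 = c6 * s"
  define p1 where "p1 = Z ^ 2 + const3 d2 * X * Y * Z + const3 d3 * X ^ 3 * Z + Y ^ 3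
       + const3 d5 * X ^ 2 * Y ^ 2 + const3 d6 * X ^ 4 * Y + const3 c7 * X ^ 6"
  have p1: "graded_equiv 1 2 3 p p1"
    by (rule graded_equiv_scale[where r = 1 and s = s and t = r])
      (simp_all add: p p1_def d2_def d3_def d5_def d6_def r s \<open>c1 \<noteq> 0\<close> \<open>c4 \<noteq> 0\<close> power_mult_distrib algebra_simps)
  define e5 e6 e7 where "e5 = d5 - d2 ^ 2 / 4" and "e6 = d6 - d2 * d3 / 2" and "e7 = c7 - d3 ^ 2 / 4"
  define p2 where "p2 = Z ^ 2 + Y ^ 3 + const3 e5 * X ^ 2 * Y ^ 2 + const3 e6 * X ^ 4 * Y + const3 e7 * X ^ 6"
  have p2: "graded_equiv 1 2 3 p1 p2"
  proof (rule graded_equiv_shear_z[where s = "const3 (- d2 / 2) * (X * Y) + const3 (- d3 / 2) * X ^ 3"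
        and f = "\<lambda>u v. - d2 / 2 * (u * v) + - d3 / 2 * u ^ 3"])
    show "const3 (- d2 / 2) * (X * Y) + const3 (- d3 / 2) * X ^ 3 \<in> graded_piece 1 2 3 3"
      using graded_piece_power[OF graded_piece_vars(1)[of 1 2 3, where 'k = 'k], of 3]
      by (intro graded_piece_add graded_piece_const_mult)
        (auto intro!: graded_piece_multI[of _ _ _ _ 1 _ 2] graded_piece_vars)
  qed (simp_all add: p1_def p2_def e5_def e6_def e7_def field_simps power2_eq_square power3_eq_cube numeral_eq_Suc)
  \<comment> \<open>Moving \<open>y\<close> by a critical point of the cubic in \<open>y\<close> removes its linear term.\<close>
  obtain e where e: "3 * e ^ 2 + (2 * e5) * e + e6 = 0"
    using quadratic_root[of 3 "2 * e5" e6] by auto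
  define B C where "B = e5 + 3 * e" and "C = e7 + e6 * e + e5 * e ^ 2 + e ^ 3"
  define p3 where "p3 = Z ^ 2 + Y ^ 3 + const3 B * X ^ 2 * Y ^ 2 + const3 C * X ^ 6"
  have p3: "graded_equiv 1 2 3 p2 p3"
  proof (rule graded_equiv_shear_y[where s = "const3 e * X ^ 2" and f = "\<lambda>u w. e * u ^ 2"])
    show "const3 e * X ^ 2 \<in> graded_piece 1 2 3 2"
      using graded_piece_power[OF graded_piece_vars(1)[of 1 2 3, where 'k = 'k], of 2]
      by (intro graded_piece_const_mult) simp
    fix u v w
    have e6: "e6 = - (3 * e ^ 2 + 2 * e5 * e)" using e by algebra
    show "eval3 p3 u v w = eval3 p2 u (v + e * u ^ 2) w"
      unfolding p2_def p3_def B_def C_def e6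
      by simp algebra
  qed simp_all
  have equiv: "graded_equiv 1 2 3 p p3"
    using p1 p2 p3 graded_equiv_trans by blast
  \<comment> \<open>With \<open>x^3 z\<close> and \<open>x^4 y\<close> gone, only \<open>x^6\<close>
    can make a partial nonzero at \<open>(1, 0, 0)\<close>.\<close>
  have "C \<noteq> 0"
    using isolated_singularityD[OF isolated_singularity_equiv[OF _ _ _ equiv iso], of 1 0 0]
    by (auto simp: p3_def)
  obtain t where t: "t ^ 6 = 1 / C" "t \<noteq> 0"
    using nth_root_nonzero[of 6 "1 / C"] \<open>C \<noteq> 0\<close> by auto
  \<comment> \<open>The final shear creates \<open>m^2 x^2 y^2\<close>, which has to cancel the term
    already present.\<close>
  obtain m where m: "m ^ 2 = - B * t ^ 2"
    using nth_root_exists[of 2 "- B * t ^ 2"] by auto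
  define p4 where "p4 = X ^ 6 + Y ^ 3 + Z ^ 2 + const3 (B * t ^ 2) * X ^ 2 * Y ^ 2"
  have p4: "graded_equiv 1 2 3 p3 p4"
    by (rule graded_equiv_scale[where r = t and s = 1 and t = 1])
      (use \<open>C \<noteq> 0\<close> in \<open>simp_all add: p3_def p4_def t power_mult_distrib algebra_simps\<close>)
  have "graded_equiv 1 2 3 p4 (X ^ 6 + Y ^ 3 + Z ^ 2 + const3 (2 * m) * X * Y * Z)"
  proof (rule graded_equiv_shear_z[where s = "const3 m * (X * Y)" and f = "\<lambda>u v. m * (u * v)"])
    show "const3 m * (X * Y) \<in> graded_piece 1 2 3 3"
      by (intro graded_piece_const_mult) (auto intro!: graded_piece_multI[of _ _ _ _ 1 _ 2] graded_piece_vars)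
    fix u v w
    have "B * t ^ 2 = - (m ^ 2)" using m by simp
    then show "eval3 (X ^ 6 + Y ^ 3 + Z ^ 2 + const3 (2 * m) * X * Y * Z) u v w = eval3 p4 u v (w + m * (u * v))"
      by (simp add: p4_def algebra_simps power2_eq_square)
  qed simp_all
  then show thesis using that equiv p4 graded_equiv_trans by blast
qed

section \<open>Weights \<open>(1, 1, 2)\<close>\<close>

lemma graded_equiv_linear_xy:
  fixes p q :: "'k::field_char_0 poly3"
  assumes pos: "1 \<le> a" "1 \<le> c" and D: "a1 * b2 - a2 * b1 \<noteq> 0"
    and "\<And>u v w. eval3 q u v w = eval3 p (a1 * u + a2 * v) (b1 * u + b2 * v) w"
  shows "graded_equiv a a c p q"
proof -
  let ?D = "a1 * b2 - a2 * b1"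
  let ?P = "const3 a1 * X + const3 a2 * Y" and ?Q = "const3 b1 * X + const3 b2 * Y"
    and ?P' = "const3 (b2 / ?D) * X + const3 (- a2 / ?D) * Y"
    and ?Q' = "const3 (- b1 / ?D) * X + const3 (a1 / ?D) * Y"
  have gr: "const3 s * X + const3 t * Y \<in> graded_piece a a c a" for s t :: 'k
    by (intro graded_piece_add graded_piece_const_mult graded_piece_vars)
  have inv: "b2 / ?D * (a1 * u + a2 * v) + - a2 / ?D * (b1 * u + b2 * v) = u"
    "- b1 / ?D * (a1 * u + a2 * v) + a1 / ?D * (b1 * u + b2 * v) = v"
    "a1 * (b2 / ?D * u + - a2 / ?D * v) + a2 * (- b1 / ?D * u + a1 / ?D * v) = u"
    "b1 * (b2 / ?D * u + - a2 / ?D * v) + b2 * (- b1 / ?D * u + a1 / ?D * v) = v" for u v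
    using D by (simp_all add: divide_simps) (simp_all add: algebra_simps)
  show ?thesis
  proof (rule graded_equiv_subst3[of a a c ?P ?Q Z ?P' ?Q' Z])
  qed (use pos in \<open>simp_all only: eval3_simps inv gr graded_piece_vars assms(4)\<close>)
qed

lemma expansion_112:
  fixes p :: "'k::comm_ring_1 poly3"
  assumes "p \<in> graded_piece 1 1 2 4"
  obtains c1 c2 c3 c4 c5 c6 c7 c8 c9 where
    "p = const3 c1 * Z ^ 2 + const3 c2 * X ^ 2 * Z + const3 c3 * X * Y * Z + const3 c4 * Y ^ 2 * Z
       + const3 c5 * X ^ 4 + const3 c6 * X ^ 3 * Y + const3 c7 * X ^ 2 * Y ^ 2 + const3 c8 * X * Y ^ 3
       + const3 c9 * Y ^ 4"
proof -
  have S: "{(i, j, k). 1 * i + 1 * j + 2 * k = (4::nat)} =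
      {(0, 0, 2), (2, 0, 1), (1, 1, 1), (0, 2, 1), (4, 0, 0), (3, 1, 0), (2, 2, 0), (1, 3, 0), (0, 4, 0)}"
    (is "?L = ?R")
  proof
    show "?L \<subseteq> ?R"
    proof
      fix x
      assume "x \<in> ?L"
      then obtain i j k where x: "x = (i, j, k)" and eq: "i + j + 2 * k = 4" by auto
      then have "k \<le> 2" "j \<le> 4" by simp_all
      then have "k = 0 \<or> k = 1 \<or> k = 2" "j = 0 \<or> j = 1 \<or> j = 2 \<or> j = 3 \<or> j = 4" by linarith+
      moreover have "i = 4 - j - 2 * k" using eq by simp
      ultimately show "x \<in> ?R" using eq x by (elim disjE) simp_all
    qed
  qed auto
  obtain f where "p = (\<Sum>(i, j, k)\<in>{(0, 0, 2), (2, 0, 1), (1, 1, 1), (0, 2, 1), (4, 0, 0), (3, 1, 0), (2, 2, 0), (1, 3, 0), (0, 4, 0)}.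
      const3 (f i j k) * X ^ i * Y ^ j * Z ^ k)"
    using graded_piece_expansion[OF order.refl order.refl one_le_numeral assms, unfolded S] by blast
  then show thesis
    by (intro that[of "f 0 0 2" "f 2 0 1" "f 1 1 1" "f 0 2 1"
          "f 4 0 0" "f 3 1 0" "f 2 2 0" "f 1 3 0" "f 0 4 0"]) (simp add: algebra_simps)
qed

lemma classify_112:
  fixes p :: "'k::{alg_closed_field, field_char_0} poly3"
  assumes gr: "p \<in> graded_piece 1 1 2 4" and iso: "isolated_singularity p"
  obtains l where "graded_equiv 1 1 2 p (X ^ 4 + Y ^ 4 + Z ^ 2 + const3 l * X * Y * Z)"
proof -
  obtain c1 c2 c3 c4 c5 c6 c7 c8 c9 where p:
    "p = const3 c1 * Z ^ 2 + const3 c2 * X ^ 2 * Z + const3 c3 * X * Y * Z + const3 c4 * Y ^ 2 * Z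
       + const3 c5 * X ^ 4 + const3 c6 * X ^ 3 * Y + const3 c7 * X ^ 2 * Y ^ 2 + const3 c8 * X * Y ^ 3
       + const3 c9 * Y ^ 4"
    using expansion_112[OF gr] .
  have iso': "isolated_singularity q" if "graded_equiv 1 1 2 p q" for q
    using isolated_singularity_equiv[OF _ _ _ that iso] by simp
  have "c1 \<noteq> 0" using isolated_singularityD[OF iso, of 0 0 1] by (auto simp: p)
  obtain r where r: "r ^ 2 = 1 / c1" "r \<noteq> 0"
    using nth_root_nonzero[of 2 "1 / c1"] \<open>c1 \<noteq> 0\<close> by auto
  have sq: "const3 a * X ^ 2 + const3 b * (X * Y) + const3 c * Y ^ 2 \<in> graded_piece 1 1 2 2" for a b c :: 'k
    using graded_piece_power[OF graded_piece_vars(1)[of 1 1 2, where 'k = 'k], of 2]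
      graded_piece_power[OF graded_piece_vars(2)[of 1 1 2, where 'k = 'k], of 2]
    by (intro graded_piece_add graded_piece_const_mult)
      (auto intro!: graded_piece_multI[of _ _ _ _ 1 _ 1] graded_piece_vars)
  define d2 d3 d4 where "d2 = c2 * r" and "d3 = c3 * r" and "d4 = c4 * r"
  define p1 where "p1 = Z ^ 2 + const3 d2 * X ^ 2 * Z + const3 d3 * X * Y * Z + const3 d4 * Y ^ 2 * Z
       + const3 c5 * X ^ 4 + const3 c6 * X ^ 3 * Y + const3 c7 * X ^ 2 * Y ^ 2 + const3 c8 * X * Y ^ 3
       + const3 c9 * Y ^ 4"
  have p1: "graded_equiv 1 1 2 p p1"
    by (rule graded_equiv_scale[where r = 1 and s = 1 and t = r])
      (simp_all add: p p1_def d2_def d3_def d4_def r \<open>c1 \<noteq> 0\<close> power_mult_distrib algebra_simps)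
  define quartic where "quartic e0 e1 e2 e3 e4 =
    Z ^ 2 + const3 e0 * X ^ 4 + const3 e1 * X ^ 3 * Y + const3 e2 * X ^ 2 * Y ^ 2 + const3 e3 * X * Y ^ 3
       + const3 e4 * Y ^ 4" for e0 e1 e2 e3 e4 :: 'k
  obtain e0 e1 e2 e3 e4 where p2: "graded_equiv 1 1 2 p1 (quartic e0 e1 e2 e3 e4)"
  proof (rule that, rule graded_equiv_shear_z[OF _ _ _ sq[of "- d2 / 2" "- d3 / 2" "- d4 / 2"]])
    show "eval3 (quartic (c5 - d2 ^ 2 / 4) (c6 - d2 * d3 / 2) (c7 - d2 * d4 / 2 - d3 ^ 2 / 4) (c8 - d3 * d4 / 2)
        (c9 - d4 ^ 2 / 4)) u v w = eval3 p1 u v (w + (- d2 / 2 * u ^ 2 + - d3 / 2 * (u * v) + - d4 / 2 * v ^ 2))" for u v w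
      by (simp add: p1_def quartic_def field_simps power2_eq_square power3_eq_cube numeral_eq_Suc)
  qed simp_all
  obtain e1 e2 e3 e4 where p3: "graded_equiv 1 1 2 p (quartic 0 e1 e2 e3 e4)"
  proof (cases "e0 = 0")
    case True
    then show ?thesis using that p1 p2 graded_equiv_trans by metis
  next
    case False
    then have "degree [:e4, e3, e2, e1, e0:] > 0" by simp
    then obtain t where "poly [:e4, e3, e2, e1, e0:] t = 0"
      using alg_closed_imp_poly_has_root by blast
    then have t: "e4 = - (e0 * t ^ 4 + e1 * t ^ 3 + e2 * t ^ 2 + e3 * t)"
      by (simp add: algebra_simps numeral_eq_Suc eq_neg_iff_add_eq_0)
    \<comment> \<open>The substitution \<open>(t u + v, u)\<close> sends \<open>(1, 0)\<close> to
      the root \<open>(t, 1)\<close>, and the coefficient of \<open>x^4\<close> is the value at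
      \<open>(1, 0)\<close>.\<close>
    have "graded_equiv 1 1 2 (quartic e0 e1 e2 e3 e4)
      (quartic 0 (4 * e0 * t ^ 3 + 3 * e1 * t ^ 2 + 2 * e2 * t + e3) (6 * e0 * t ^ 2 + 3 * e1 * t + e2) (4 * e0 * t + e1) e0)"
      by (rule graded_equiv_linear_xy[of _ _ t 0 1 1])
        (simp_all add: quartic_def t algebra_simps power2_eq_square power3_eq_cube numeral_eq_Suc)
    then show ?thesis using that p1 p2 graded_equiv_trans by metis
  qed
  \<comment> \<open>Otherwise \<open>(1 : 0)\<close> would be a multiple root of the binary quartic
    and \<open>(1, 0, 0)\<close> singular. The remaining cubic factor thus has a root
    \<open>(t : 1)\<close>, which \<open>(u + t v, v)\<close> moves to \<open>(0 : 1)\<close> while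
    fixing the first root.\<close>
  have "e1 \<noteq> 0"
    using isolated_singularityD[OF iso'[OF p3], of 1 0 0] by (auto simp: quartic_def)
  have "degree [:e4, e3, e2, e1:] > 0" using \<open>e1 \<noteq> 0\<close> by simp
  then obtain t where "poly [:e4, e3, e2, e1:] t = 0"
    using alg_closed_imp_poly_has_root by blast
  then have t: "e4 = - (e1 * t ^ 3 + e2 * t ^ 2 + e3 * t)"
    by (simp add: algebra_simps numeral_eq_Suc eq_neg_iff_add_eq_0)
  define B C where "B = 3 * e1 * t + e2" and "C = 3 * e1 * t ^ 2 + 2 * e2 * t + e3"
  have "graded_equiv 1 1 2 (quartic 0 e1 e2 e3 e4) (quartic 0 e1 B C 0)"
    by (rule graded_equiv_linear_xy[of _ _ 1 1 t 0])
      (simp_all add: quartic_def t B_def C_def algebra_simps power2_eq_square power3_eq_cube numeral_eq_Suc)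
  then have p4: "graded_equiv 1 1 2 p (quartic 0 e1 B C 0)" using p3 graded_equiv_trans by blast
  have "C \<noteq> 0"
    using isolated_singularityD[OF iso'[OF p4], of 0 1 0] by (auto simp: quartic_def)
  \<comment> \<open>The quartic is now \<open>x y (e1 x\<^sup>2 + B x y + C y\<^sup>2)\<close>; for \<open>s\<^sup>2 = e1 / C\<close> the coordinates
    \<open>x = u + v\<close>, \<open>y = s (u - v)\<close> turn both quadratic factors into combinations of \<open>u\<^sup>2\<close> and \<open>v\<^sup>2\<close>.\<close>
  obtain s where s: "s ^ 2 = e1 / C" "s \<noteq> 0"
    using nth_root_nonzero[of 2 "e1 / C"] \<open>C \<noteq> 0\<close> \<open>e1 \<noteq> 0\<close> by auto
  define \<alpha> \<beta> \<gamma> where "\<alpha> = s * (2 * e1 + B * s)" and "\<beta> = - 2 * B * s ^ 2" and "\<gamma> = - s * (2 * e1 - B * s)"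
  have "graded_equiv 1 1 2 (quartic 0 e1 B C 0) (quartic \<alpha> 0 \<beta> 0 \<gamma>)"
  proof (rule graded_equiv_linear_xy[of _ _ 1 "- s" 1 s])
    have e1: "e1 = C * s * s" using s \<open>C \<noteq> 0\<close> by (simp add: power2_eq_square field_simps)
    show "eval3 (quartic \<alpha> 0 \<beta> 0 \<gamma>) u v w = eval3 (quartic 0 e1 B C 0) (1 * u + 1 * v) (s * u + - s * v) w" for u v w
      by (simp add: quartic_def \<alpha>_def \<beta>_def \<gamma>_def e1 algebra_simps power2_eq_square power3_eq_cube numeral_eq_Suc)
  qed (use s in auto)
  then have p5: "graded_equiv 1 1 2 p (quartic \<alpha> 0 \<beta> 0 \<gamma>)" using p4 graded_equiv_trans by blast
  have "\<alpha> \<noteq> 0" "\<gamma> \<noteq> 0"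
    using isolated_singularityD[OF iso'[OF p5], of 1 0 0] isolated_singularityD[OF iso'[OF p5], of 0 1 0]
    by (auto simp: quartic_def)
  obtain x where x: "x ^ 4 = 1 / \<alpha>" "x \<noteq> 0"
    using nth_root_nonzero[of 4 "1 / \<alpha>"] \<open>\<alpha> \<noteq> 0\<close> by auto
  obtain y where y: "y ^ 4 = 1 / \<gamma>" "y \<noteq> 0"
    using nth_root_nonzero[of 4 "1 / \<gamma>"] \<open>\<gamma> \<noteq> 0\<close> by auto
  define B' where "B' = \<beta> * x ^ 2 * y ^ 2"
  have p6: "graded_equiv 1 1 2 (quartic \<alpha> 0 \<beta> 0 \<gamma>) (quartic 1 0 B' 0 1)"
    by (rule graded_equiv_scale[where r = x and s = y and t = 1])
      (use \<open>\<alpha> \<noteq> 0\<close> \<open>\<gamma> \<noteq> 0\<close> in \<open>simp_all add: quartic_def B'_def x y power_mult_distrib algebra_simps\<close>)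
  obtain m where m: "m ^ 2 = - B'"
    using nth_root_exists[of 2 "- B'"] by auto
  have "graded_equiv 1 1 2 (quartic 1 0 B' 0 1) (X ^ 4 + Y ^ 4 + Z ^ 2 + const3 (2 * m) * X * Y * Z)"
  proof (rule graded_equiv_shear_z[OF _ _ _ sq[of 0 m 0]])
    have "B' = - (m ^ 2)" using m by simp
    then show "eval3 (X ^ 4 + Y ^ 4 + Z ^ 2 + const3 (2 * m) * X * Y * Z) u v w =
        eval3 (quartic 1 0 B' 0 1) u v (w + (0 * u ^ 2 + m * (u * v) + 0 * v ^ 2))" for u v w
      by (simp add: quartic_def algebra_simps power2_eq_square)
  qed simp_all
  then show thesis using that p5 p6 graded_equiv_trans by blast
qed

section \<open>Weights \<open>(1, 1, 1)\<close>\<close>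

lemma graded_piece_linear:
  "const3 r * X + const3 s * Y + const3 t * Z \<in> graded_piece 1 1 1 1"
  for r s t :: "'k::comm_ring_1"
  by (intro graded_piece_add graded_piece_const_mult graded_piece_vars)

lemma graded_equiv_linear_subst3:
  fixes p :: "'k::field_char_0 poly3"
  assumes D: "a1 * (b2 * c3 - b3 * c2) - a2 * (b1 * c3 - b3 * c1) + a3 * (b1 * c2 - b2 * c1) \<noteq> 0"
  shows "graded_equiv 1 1 1 p (subst3
    (const3 a1 * X + const3 a2 * Y + const3 a3 * Z)
    (const3 b1 * X + const3 b2 * Y + const3 b3 * Z)
    (const3 c1 * X + const3 c2 * Y + const3 c3 * Z) p)" (is "graded_equiv 1 1 1 p (subst3 ?P ?Q ?R p)")
proof -
  define D where "D = a1 * (b2 * c3 - b3 * c2) - a2 * (b1 * c3 - b3 * c1) + a3 * (b1 * c2 - b2 * c1)"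
  have "D \<noteq> 0" using D by (simp only: D_def not_False_eq_True)
  \<comment> \<open>The inverse matrix is the adjugate divided by \<open>D\<close>. The two facts
    \<open>solve\<close> and \<open>solve'\<close> clear this denominator, leaving polynomial
    identities.\<close>
  have solve: "x / D * u + y / D * v + z / D * w = t" if "x * u + y * v + z * w = D * t" for x y z u v w t
  proof -
    have "x / D * u + y / D * v + z / D * w = (x * u + y * v + z * w) / D"
      by (simp add: add_divide_distrib)
    then show ?thesis using that \<open>D \<noteq> 0\<close> by simp
  qed
  have solve': "x * (u1 / D * u + v1 / D * v + w1 / D * w) + y * (u2 / D * u + v2 / D * v + w2 / D * w)
      + z * (u3 / D * u + v3 / D * v + w3 / D * w) = t"
    if "x * (u1 * u + v1 * v + w1 * w) + y * (u2 * u + v2 * v + w2 * w) + z * (u3 * u + v3 * v + w3 * w) = D * t"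
    for x y z u v w t u1 v1 w1 u2 v2 w2 u3 v3 w3
  proof -
    have "x * (u1 / D * u + v1 / D * v + w1 / D * w) + y * (u2 / D * u + v2 / D * v + w2 / D * w)
        + z * (u3 / D * u + v3 / D * v + w3 / D * w)
      = (x * (u1 * u + v1 * v + w1 * w) + y * (u2 * u + v2 * v + w2 * w) + z * (u3 * u + v3 * v + w3 * w)) / D"
      by (simp add: add_divide_distrib distrib_left)
    then show ?thesis using that \<open>D \<noteq> 0\<close> by simp
  qed
  let ?P' = "const3 ((b2 * c3 - b3 * c2) / D) * X + const3 ((a3 * c2 - a2 * c3) / D) * Y + const3 ((a2 * b3 - a3 * b2) / D) * Z"
    and ?Q' = "const3 ((b3 * c1 - b1 * c3) / D) * X + const3 ((a1 * c3 - a3 * c1) / D) * Y + const3 ((a3 * b1 - a1 * b3) / D) * Z"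
    and ?R' = "const3 ((b1 * c2 - b2 * c1) / D) * X + const3 ((a2 * c1 - a1 * c2) / D) * Y + const3 ((a1 * b2 - a2 * b1) / D) * Z"
  show ?thesis
  proof (rule graded_equiv_subst3[of 1 1 1 ?P ?Q ?R ?P' ?Q' ?R'])
    fix u v w
    show "eval3 ?P' (eval3 ?P u v w) (eval3 ?Q u v w) (eval3 ?R u v w) = u"
      unfolding eval3_simps by (rule solve) (simp add: D_def algebra_simps)
    show "eval3 ?Q' (eval3 ?P u v w) (eval3 ?Q u v w) (eval3 ?R u v w) = v"
      unfolding eval3_simps by (rule solve) (simp add: D_def algebra_simps)
    show "eval3 ?R' (eval3 ?P u v w) (eval3 ?Q u v w) (eval3 ?R u v w) = w"
      unfolding eval3_simps by (rule solve) (simp add: D_def algebra_simps)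
    show "eval3 ?P (eval3 ?P' u v w) (eval3 ?Q' u v w) (eval3 ?R' u v w) = u"
      unfolding eval3_simps by (rule solve') (simp add: D_def algebra_simps)
    show "eval3 ?Q (eval3 ?P' u v w) (eval3 ?Q' u v w) (eval3 ?R' u v w) = v"
      unfolding eval3_simps by (rule solve') (simp add: D_def algebra_simps)
    show "eval3 ?R (eval3 ?P' u v w) (eval3 ?Q' u v w) (eval3 ?R' u v w) = w"
      unfolding eval3_simps by (rule solve') (simp add: D_def algebra_simps)
    show "eval3 (subst3 ?P ?Q ?R p) u v w = eval3 p (eval3 ?P u v w) (eval3 ?Q u v w) (eval3 ?R u v w)"
      by simp
  qed (rule graded_piece_linear order.refl)+
qed

lemma graded_equiv_linear:
  fixes p q :: "'k::field_char_0 poly3"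
  assumes D: "a1 * (b2 * c3 - b3 * c2) - a2 * (b1 * c3 - b3 * c1) + a3 * (b1 * c2 - b2 * c1) \<noteq> 0"
    and "\<And>u v w. eval3 q u v w =
      eval3 p (a1 * u + a2 * v + a3 * w) (b1 * u + b2 * v + b3 * w) (c1 * u + c2 * v + c3 * w)"
  shows "graded_equiv 1 1 1 p q"
proof -
  have "q = subst3
    (const3 a1 * X + const3 a2 * Y + const3 a3 * Z)
    (const3 b1 * X + const3 b2 * Y + const3 b3 * Z)
    (const3 c1 * X + const3 c2 * Y + const3 c3 * Z) p"
    by (rule poly3_eqI) (simp add: assms(2))
  then show ?thesis using graded_equiv_linear_subst3[OF D] by simp
qed

lemma graded_equiv_piece:
  assumes "graded_equiv a b c p q" and "p \<in> graded_piece a b c d"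
  shows "q \<in> graded_piece a b c d"
  using assms unfolding graded_equiv_def graded_automorphism_def by blast

definition cubic3 :: "'k \<Rightarrow> 'k \<Rightarrow> 'k \<Rightarrow> 'k \<Rightarrow> 'k \<Rightarrow> 'k \<Rightarrow> 'k \<Rightarrow> 'k \<Rightarrow> 'k \<Rightarrow> 'k \<Rightarrow> 'k::comm_ring_1 poly3" where
  "cubic3 a b c d e f g h i j =
     const3 a * X ^ 3 + const3 b * X ^ 2 * Y + const3 c * X ^ 2 * Z
     + const3 d * X * Y ^ 2 + const3 e * X * Y * Z + const3 f * X * Z ^ 2
     + const3 g * Y ^ 3 + const3 h * Y ^ 2 * Z + const3 i * Y * Z ^ 2 + const3 j * Z ^ 3"

lemma eval3_cubic3:
  "eval3 (cubic3 a b c d e f g h i j) u v w =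
     a * u ^ 3 + b * u ^ 2 * v + c * u ^ 2 * w + d * u * v ^ 2 + e * u * v * w + f * u * w ^ 2
     + g * v ^ 3 + h * v ^ 2 * w + i * v * w ^ 2 + j * w ^ 3"
  for a :: "'k::comm_ring_1"
  by (simp add: cubic3_def)

lemma cubic3_graded: "cubic3 a b c d e f g h i j \<in> graded_piece 1 1 1 3" for a :: "'k::comm_ring_1"
proof -
  have mono: "const3 t * X ^ i * Y ^ j * Z ^ k \<in> graded_piece 1 1 1 (0 + 1 * i + 1 * j + 1 * k)"
    for t :: 'k and i j k
    by (intro graded_piece_mult graded_piece_power graded_piece_const graded_piece_vars)
  have "const3 a * X ^ 3 * Y ^ 0 * Z ^ 0 + const3 b * X ^ 2 * Y ^ 1 * Z ^ 0 + const3 c * X ^ 2 * Y ^ 0 * Z ^ 1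
     + const3 d * X ^ 1 * Y ^ 2 * Z ^ 0 + const3 e * X ^ 1 * Y ^ 1 * Z ^ 1 + const3 f * X ^ 1 * Y ^ 0 * Z ^ 2
     + const3 g * X ^ 0 * Y ^ 3 * Z ^ 0 + const3 h * X ^ 0 * Y ^ 2 * Z ^ 1 + const3 i * X ^ 0 * Y ^ 1 * Z ^ 2
     + const3 j * X ^ 0 * Y ^ 0 * Z ^ 3 \<in> graded_piece 1 1 1 3"
    using mono[of a 3 0 0] mono[of b 2 1 0] mono[of c 2 0 1] mono[of d 1 2 0] mono[of e 1 1 1]
      mono[of f 1 0 2] mono[of g 0 3 0] mono[of h 0 2 1] mono[of i 0 1 2] mono[of j 0 0 3]
    by (intro graded_piece_add) (simp_all add: numeral_eq_Suc)
  then show ?thesis by (simp add: cubic3_def)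
qed

lemma expansion_111:
  fixes p :: "'k::comm_ring_1 poly3"
  assumes "p \<in> graded_piece 1 1 1 3"
  obtains a b c d e f g h i j where "p = cubic3 a b c d e f g h i j"
proof -
  have S: "{(i, j, k). 1 * i + 1 * j + 1 * k = (3::nat)} =
      {(3, 0, 0), (2, 1, 0), (2, 0, 1), (1, 2, 0), (1, 1, 1), (1, 0, 2), (0, 3, 0), (0, 2, 1), (0, 1, 2), (0, 0, 3)}"
    (is "?L = ?R")
  proof
    show "?L \<subseteq> ?R"
    proof
      fix x
      assume "x \<in> ?L"
      then obtain i j k where x: "x = (i, j, k)" and eq: "i + j + k = 3" by auto
      then have "k \<le> 3" "j \<le> 3" by simp_all
      then have "k = 0 \<or> k = 1 \<or> k = 2 \<or> k = 3" "j = 0 \<or> j = 1 \<or> j = 2 \<or> j = 3" by linarith+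
      moreover have "i = 3 - j - k" using eq by simp
      ultimately show "x \<in> ?R" using eq x by (elim disjE) simp_all
    qed
  qed auto
  obtain f where "p = (\<Sum>(i, j, k)\<in>{(3, 0, 0), (2, 1, 0), (2, 0, 1), (1, 2, 0), (1, 1, 1), (1, 0, 2), (0, 3, 0), (0, 2, 1), (0, 1, 2), (0, 0, 3)}.
      const3 (f i j k) * X ^ i * Y ^ j * Z ^ k)"
    using graded_piece_expansion[OF order.refl order.refl order.refl assms, unfolded S] by blast
  then show thesis
    by (intro that[of "f 3 0 0" "f 2 1 0" "f 2 0 1" "f 1 2 0" "f 1 1 1" "f 1 0 2" "f 0 3 0" "f 0 2 1" "f 0 1 2" "f 0 0 3"])
      (simp add: cubic3_def algebra_simps)
qed

section \<open>Existence of a flex\<close>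

text \<open>
  The conclusion says that \<open>x y\<^sup>2 + x\<^sup>2 z + D x z\<^sup>2 + E y z\<^sup>2 + F z\<^sup>3\<close> restricts to \<open>m (y + s z)\<^sup>3\<close> on the
  line \<open>x = m y + n z\<close>. With \<open>s = m + g\<close>, the first equation gives \<open>n\<close>, the second reads
  \<open>3 m g\<^sup>2 = k\<close> and, modulo the second, the third is \<open>u + g v = 0\<close>, where \<open>k\<close>, \<open>u\<close>, \<open>v\<close> are polynomials
  in \<open>m\<close>. Eliminating \<open>g\<close> leaves \<open>3 m u\<^sup>2 = k v\<^sup>2\<close>, an equation of degree 9 in \<open>m\<close>.
\<close>

lemma flex_line:
  fixes D E F :: "'k::{alg_closed_field, field_char_0}"
  assumes "E \<noteq> 0"
  obtains m s n where "m \<noteq> 0" "n + m ^ 2 = 3 * m * s" "2 * m * n + D * m + E = 3 * m * s ^ 2"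
    "n ^ 2 + D * n + F = m * s ^ 3"
proof -
  define K U V where "K = [:E, D, 0, 1:]" and "U = [:F, 2 * E, 4 * D, 0, 5:]" and "V = [:- E, 8 * D, 0, 26:]"
  define R where "R = [:0, 27:] * U ^ 2 - K * V ^ 2"
  \<comment> \<open>The coefficient is \<open>27 * 5^2 - 26^2 = 675 - 676\<close>. It never
    vanishes, so \<open>R\<close> has a root for all \<open>D\<close>, \<open>E\<close>,
    \<open>F\<close>.\<close>
  have "coeff R 9 = - 1"
    by (simp add: R_def K_def U_def V_def power2_eq_square numeral_eq_Suc)
  then have "degree R > 0" by (metis coeff_eq_0 neg_equal_0_iff_equal not_gr_zero zero_less_numeral one_neq_zero)
  then obtain m where "poly R m = 0" using alg_closed_imp_poly_has_root by blast
  define k u v where "k = m ^ 3 + D * m + E" and "u = 5 * m ^ 4 + 4 * D * m ^ 2 + 2 * E * m + F"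
    and "v = (26 * m ^ 3 + 8 * D * m - E) / 3"
  have "poly K m = k" "poly U m = u" "poly V m = 3 * v"
    by (simp_all add: K_def U_def V_def k_def u_def v_def algebra_simps numeral_eq_Suc)
  with \<open>poly R m = 0\<close> have "27 * m * u ^ 2 = k * (3 * v) ^ 2"
    by (simp add: R_def)
  then have R: "3 * m * u ^ 2 = k * v ^ 2"
    by (simp add: power_mult_distrib mult.assoc)
  \<comment> \<open>At \<open>m = 0\<close> the eliminated equation reads
    \<open>0 = E^3 / 9\<close>.\<close>
  have "m \<noteq> 0"
  proof
    assume "m = 0"
    then have "k = E" "v = - E / 3" by (simp_all add: k_def v_def)
    with R \<open>m = 0\<close> show False using assms by simp
  qed
  \<comment> \<open>If \<open>v = 0\<close>, then also \<open>u = 0\<close>, and any root of the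
    quadratic equation serves. Otherwise the linear equation determines \<open>g\<close>, and the
    eliminated equation is the quadratic one.\<close>
  obtain g where g: "u + g * v = 0" "3 * m * g ^ 2 = k"
  proof (cases "v = 0")
    case True
    then have "u = 0" using R \<open>m \<noteq> 0\<close> by simp
    obtain g where "g ^ 2 = k / (3 * m)" using nth_root_exists[of 2 "k / (3 * m)"] by auto
    then show thesis using that[of g] True \<open>u = 0\<close> \<open>m \<noteq> 0\<close> by simp
  next
    case False
    then show thesis using that[of "- u / v"] R by (simp add: power_divide)
  qed
  define s n where "s = m + g" and "n = 2 * m ^ 2 + 3 * m * g"
  have "n + m ^ 2 = 3 * m * s" "2 * m * n + D * m + E = 3 * m * s ^ 2"
    using g(2) by (simp_all add: s_def n_def k_def algebra_simps power2_eq_square power3_eq_cube)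
  moreover have "3 * (n ^ 2 + D * n + F - m * s ^ 3) = 3 * (u + g * v) + (k - 3 * m * g ^ 2) * (g - 6 * m)"
    by (simp add: s_def n_def k_def u_def v_def algebra_simps add_divide_distrib diff_divide_distrib
      power2_eq_square power3_eq_cube numeral_eq_Suc)
  then have "3 * (n ^ 2 + D * n + F - m * s ^ 3) = 0"
    using g by (simp only: diff_self mult_zero_left mult_zero_right add_0)
  then have "n ^ 2 + D * n + F = m * s ^ 3" by (simp only: mult_eq_0_iff) simp
  ultimately show thesis using that \<open>m \<noteq> 0\<close> by blast
qed

lemma isolated_singularity_linear_equiv:
  fixes p q :: "'k::field_char_0 poly3"
  assumes "graded_equiv 1 1 1 p q" and "isolated_singularity p"
  shows "isolated_singularity q"
  using isolated_singularity_equiv[OF order.refl order.refl order.refl] assms .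

text \<open>A point of the cubic is moved to \<open>(1 : 0 : 0)\<close> and its tangent to
  \<open>z = 0\<close>, which removes \<open>x^3\<close> and \<open>x^2 y\<close>.\<close>

lemma move_to_tangent:
  fixes p :: "'k::{alg_closed_field, field_char_0} poly3"
  assumes gr: "p \<in> graded_piece 1 1 1 3" and iso: "isolated_singularity p"
  obtains d e f g h i j where "graded_equiv 1 1 1 p (cubic3 0 0 1 d e f g h i j)"
proof -
  obtain p1 where p1: "graded_equiv 1 1 1 p p1" and z: "eval3 p1 1 0 0 = 0"
  proof (cases "eval3 p 1 0 0 = 0")
    case True
    have "graded_equiv 1 1 1 p p"
      by (rule graded_equiv_linear[of 1 1 1 0 0 0 0 0 0]) simp_all
    then show ?thesis using that True by blast
  next
    case False
    obtain a b c d e f g h i j where p: "p = cubic3 a b c d e f g h i j"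
      using expansion_111[OF gr] .
    have "a \<noteq> 0" using False by (simp add: p eval3_cubic3)
    then have "degree [:g, d, b, a:] > 0" by simp
    then obtain t where t: "poly [:g, d, b, a:] t = 0"
      using alg_closed_imp_poly_has_root by blast
    let ?q = "subst3 (const3 t * X + const3 1 * Y + const3 0 * Z) (const3 1 * X + const3 0 * Y + const3 0 * Z)
      (const3 0 * X + const3 0 * Y + const3 1 * Z) p"
    have "graded_equiv 1 1 1 p ?q" by (rule graded_equiv_linear_subst3) simp
    moreover have "eval3 ?q 1 0 0 = 0"
      using t by (simp add: p eval3_cubic3 algebra_simps power2_eq_square power3_eq_cube)
    ultimately show ?thesis by (rule that)
  qed
  obtain a b c d e f g h i j where "p1 = cubic3 a b c d e f g h i j"
    using expansion_111[OF graded_equiv_piece[OF p1 gr]] .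
  with z have p1_eq: "p1 = cubic3 0 b c d e f g h i j" by (simp add: eval3_cubic3)
  \<comment> \<open>These are the only possibly nonzero entries of the gradient at
    \<open>(1, 0, 0)\<close>. After a swap of \<open>y\<close> and \<open>z\<close> if
    \<open>c = 0\<close>, the tangent form \<open>b y + c z\<close> becomes the new
    \<open>z\<close>.\<close>
  have bc: "b \<noteq> 0 \<or> c \<noteq> 0"
    using isolated_singularityD[OF isolated_singularity_linear_equiv[OF p1 iso], of 1 0 0]
    by (auto simp: p1_eq cubic3_def)
  obtain b c d e f g h i j where p2: "graded_equiv 1 1 1 p (cubic3 0 b c d e f g h i j)" and "c \<noteq> 0"
  proof (cases "c = 0")
    case True
    have "graded_equiv 1 1 1 (cubic3 0 b c d e f g h i j) (cubic3 0 c b f e d j i h g)"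
      by (rule graded_equiv_linear[of 1 0 0 1 1 0 0 0 0]) (simp_all add: eval3_cubic3)
    then show ?thesis using that[of c b] bc True p1 p1_eq graded_equiv_trans by blast
  next
    case False
    then show ?thesis using that p1 p1_eq by blast
  qed
  define r s where "r = 1 / c" and "s = - b / c"
  have "graded_equiv 1 1 1 (cubic3 0 b c d e f g h i j)
    (cubic3 0 0 1 (d + e * s + f * s ^ 2) (e * r + 2 * f * r * s) (f * r ^ 2)
      (g + h * s + i * s ^ 2 + j * s ^ 3) (h * r + 2 * i * r * s + 3 * j * r * s ^ 2)
      (i * r ^ 2 + 3 * j * r ^ 2 * s) (j * r ^ 3))"
  proof (rule graded_equiv_linear[of 1 1 r 0 s 0 0 0 0])
    have "b = - c * s" "c * r = 1" using \<open>c \<noteq> 0\<close> by (simp_all add: r_def s_def)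
    fix u v w
    have "b * u ^ 2 * v + c * u ^ 2 * (s * v + r * w) = u ^ 2 * w"
      using \<open>c * r = 1\<close> unfolding \<open>b = - c * s\<close> by algebra
    then show "eval3 (cubic3 0 0 1 (d + e * s + f * s ^ 2) (e * r + 2 * f * r * s) (f * r ^ 2)
      (g + h * s + i * s ^ 2 + j * s ^ 3) (h * r + 2 * i * r * s + 3 * j * r * s ^ 2)
      (i * r ^ 2 + 3 * j * r ^ 2 * s) (j * r ^ 3)) u v w
      = eval3 (cubic3 0 b c d e f g h i j) (1 * u + 0 * v + 0 * w) (0 * u + 1 * v + 0 * w) (0 * u + s * v + r * w)"
      by (simp add: eval3_cubic3 algebra_simps power2_eq_square power3_eq_cube)
  qed (use \<open>c \<noteq> 0\<close> in \<open>simp add: r_def\<close>)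
  then show thesis using that p2 graded_equiv_trans by blast
qed

text \<open>The target restricts to \<open>g' y^3\<close> on \<open>z = 0\<close>, so
  \<open>z = 0\<close> is a flex tangent at \<open>(1 : 0 : 0)\<close> once \<open>g'\<close> is
  known to be nonzero. For \<open>d = 0\<close> the given tangent already has this property.\<close>

lemma flex_form_of_tangent_form:
  fixes d e f g h i j :: "'k::{alg_closed_field, field_char_0}"
  assumes iso: "isolated_singularity (cubic3 0 0 1 d e f g h i j)"
  obtains c e' f' g' h' i' j' where
    "graded_equiv 1 1 1 (cubic3 0 0 1 d e f g h i j) (cubic3 0 0 c 0 e' f' g' h' i' j')"
proof (cases "d = 0")
  case True
  have "graded_equiv 1 1 1 (cubic3 0 0 1 d e f g h i j) (cubic3 0 0 1 d e f g h i j)"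
    by (rule graded_equiv_linear[of 1 1 1 0 0 0 0 0 0]) simp_all
  then show ?thesis using that True by blast
next
  case False
  define r t where "r = 1 / d" and "t = d ^ 2"
  have rt: "r * d = 1" "r ^ 2 * t = 1" using False by (simp_all add: r_def t_def field_simps)
  define e1 f1 h1 i1 j1 where "e1 = e * r * t" and "f1 = f * r * t ^ 2" and "h1 = h * t" and "i1 = i * t ^ 2" and "j1 = j * t ^ 3"
  have 1: "graded_equiv 1 1 1 (cubic3 0 0 1 d e f g h i j) (cubic3 0 0 1 1 e1 f1 g h1 i1 j1)"
  proof (rule graded_equiv_scale[of _ _ _ r 1 t])
    fix u v w
    have "eval3 (cubic3 0 0 1 1 e1 f1 g h1 i1 j1) u v w - eval3 (cubic3 0 0 1 d e f g h i j) (r * u) (1 * v) (t * w)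
        = (1 - r ^ 2 * t) * (u ^ 2 * w) + (1 - r * d) * (u * v ^ 2)"
      by (simp add: eval3_cubic3 e1_def f1_def h1_def i1_def j1_def algebra_simps power2_eq_square power3_eq_cube)
    then show "eval3 (cubic3 0 0 1 1 e1 f1 g h1 i1 j1) u v w
        = eval3 (cubic3 0 0 1 d e f g h i j) (r * u) (1 * v) (t * w)"
      by (simp add: rt)
  qed (use False in \<open>simp_all add: r_def t_def\<close>)
  \<comment> \<open>In the substitution of \<open>x + p y + q z\<close> for \<open>x\<close> and
    \<open>y + s z\<close> for \<open>y\<close>, the choice of \<open>p\<close> removes
    \<open>y^3\<close>, that of \<open>s\<close> removes \<open>x y z\<close>, and that of
    \<open>q\<close> removes \<open>y^2 z\<close>.\<close>
  define p s where "p = - g" and "s = g - e1 / 2"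
  define q where "q = - (p ^ 2 + 2 * p * s + e1 * p + 3 * g * s + h1)"
  define D E F where "D = 2 * q + s ^ 2 + e1 * s + f1"
    and "E = 2 * p * q + p * s ^ 2 + 2 * q * s + e1 * (p * s + q) + f1 * p + 3 * g * s ^ 2 + 2 * h1 * s + i1"
    and "F = q ^ 2 + q * s ^ 2 + e1 * q * s + f1 * q + g * s ^ 3 + h1 * s ^ 2 + i1 * s + j1"
  have 2: "graded_equiv 1 1 1 (cubic3 0 0 1 1 e1 f1 g h1 i1 j1) (cubic3 0 0 1 1 0 D 0 0 E F)"
  proof (rule graded_equiv_linear[of 1 1 1 s 0 p 0 0 q])
    have eqs: "g = - p" "e1 = - 2 * p - 2 * s" "h1 = - (q + p ^ 2 + 2 * p * s + e1 * p + 3 * g * s)"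
      by (simp_all add: p_def s_def q_def algebra_simps)
    fix u v w
    show "eval3 (cubic3 0 0 1 1 0 D 0 0 E F) u v w
        = eval3 (cubic3 0 0 1 1 e1 f1 g h1 i1 j1) (1 * u + p * v + q * w) (0 * u + 1 * v + s * w) (0 * u + 0 * v + 1 * w)"
      unfolding eval3_cubic3 D_def E_def F_def eqs
      by (simp add: algebra_simps power2_eq_square power3_eq_cube)
  qed simp
  note 12 = graded_equiv_trans[OF 1 2]
  show ?thesis
  proof (cases "E = 0")
    case True
    \<comment> \<open>For \<open>E = 0\<close> the cubic restricts to \<open>F z^3\<close> on
      \<open>x = 0\<close>; a cyclic permutation of the variables brings this line to
      \<open>z = 0\<close>.\<close>
    have "graded_equiv 1 1 1 (cubic3 0 0 1 1 0 D 0 0 E F) (cubic3 0 0 1 0 0 0 F D 1 0)"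
      by (rule graded_equiv_linear[of 0 0 0 0 1 0 1 0 1]) (simp_all add: eval3_cubic3 True algebra_simps power2_eq_square)
    then show ?thesis using that 12 graded_equiv_trans by blast
  next
    case False
    then obtain m s n where m: "m \<noteq> 0" "n + m ^ 2 = 3 * m * s" "2 * m * n + D * m + E = 3 * m * s ^ 2"
      "n ^ 2 + D * n + F = m * s ^ 3"
      by (rule flex_line)
    \<comment> \<open>In the new coordinates the line \<open>x = m y + n z\<close> is the vanishing
      of the third one, and \<open>y + s z\<close> is the second one.\<close>
    let ?L = "const3 (n - m * s) * X + const3 m * Y + const3 1 * Z"
    let ?q = "subst3 ?L (const3 (- s) * X + const3 1 * Y + const3 0 * Z)
      (const3 1 * X + const3 0 * Y + const3 0 * Z) (cubic3 0 0 1 1 0 D 0 0 E F)"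
    have 3: "graded_equiv 1 1 1 (cubic3 0 0 1 1 0 D 0 0 E F) ?q"
      by (rule graded_equiv_linear_subst3) (simp add: m)
    obtain a' b' c' d' e' f' g' h' i' j' where q: "?q = cubic3 a' b' c' d' e' f' g' h' i' j'"
      using expansion_111[OF graded_equiv_piece[OF 3 cubic3_graded]] .
    have ev: "eval3 ?q u v 0 = m * v ^ 3" for u v
    proof -
      have eqs: "n = 3 * m * s - m ^ 2" "E = 3 * m * s ^ 2 - 2 * m * n - D * m" "F = m * s ^ 3 - n ^ 2 - D * n"
        using m by (simp_all add: algebra_simps)
      show ?thesis
        unfolding eval3_subst3 eval3_cubic3 eqs(2,3) eval3_simps unfolding eqs(1)
        by (simp add: algebra_simps power2_eq_square power3_eq_cube)
    qed
    have "a' = 0" using ev[of 1 0] unfolding q by (simp add: eval3_cubic3)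
    \<comment> \<open>The coefficients on the line are recovered from a few values, which avoids
      expanding the whole substitution.\<close>
    have sums: "b' + d' + g' = m" "g' = m" "- b' + d' - g' = - m"
      using ev[of 1 1] ev[of 0 1] ev[of 1 "- 1"] unfolding q by (simp_all add: eval3_cubic3 \<open>a' = 0\<close>)
    have "2 * d' = (b' + d' + g') + (- b' + d' - g')" by simp
    also have "\<dots> = 0" unfolding sums(1,3) by simp
    finally have "d' = 0" by simp
    moreover from this have "b' = 0" using sums by simp
    ultimately show ?thesis using that q \<open>a' = 0\<close> 12 3 graded_equiv_trans by metis
  qed
qed

lemma weierstrass_of_flex_form:
  fixes c e f g h i j :: "'k::{alg_closed_field, field_char_0}"
  assumes iso: "isolated_singularity (cubic3 0 0 c 0 e f g h i j)"
  obtains \<alpha> \<beta> where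
    "graded_equiv 1 1 1 (cubic3 0 0 c 0 e f g h i j) (cubic3 0 0 1 0 0 0 1 0 \<alpha> \<beta>)"
proof -
  have "c \<noteq> 0"
    using isolated_singularityD[OF iso, of 1 0 0] by (auto simp: cubic3_def)
  \<comment> \<open>For \<open>g = 0\<close> the cubic is divisible by \<open>z\<close> and singular
    where the line \<open>z = 0\<close> meets the residual conic.\<close>
  have "g \<noteq> 0"
  proof
    assume "g = 0"
    obtain u v where uv: "c * u ^ 2 + e * u * v + h * v ^ 2 = 0" "u \<noteq> 0 \<or> v \<noteq> 0"
      using quadratic_form_root by blast
    have "eval3 (dZ (cubic3 0 0 c 0 e f 0 h i j)) u v 0 = c * u ^ 2 + e * u * v + h * v ^ 2"
      by (simp add: cubic3_def algebra_simps)
    then show False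
      using isolated_singularityD[OF iso, of u v 0] uv \<open>g = 0\<close> by (auto simp: cubic3_def)
  qed
  obtain r where r: "r ^ 2 = 1 / c" "r \<noteq> 0"
    using nth_root_nonzero[of 2 "1 / c"] \<open>c \<noteq> 0\<close> by auto
  obtain s where s: "s ^ 3 = 1 / g" "s \<noteq> 0"
    using nth_root_nonzero[of 3 "1 / g"] \<open>g \<noteq> 0\<close> by auto
  define e1 f1 h1 i1 where "e1 = e * r * s" and "f1 = f * r" and "h1 = h * s ^ 2" and "i1 = i * s"
  have 1: "graded_equiv 1 1 1 (cubic3 0 0 c 0 e f g h i j) (cubic3 0 0 1 0 e1 f1 1 h1 i1 j)"
    by (rule graded_equiv_scale[of _ _ _ r s 1])
      (use \<open>c \<noteq> 0\<close> \<open>g \<noteq> 0\<close> r s in \<open>simp_all add: eval3_cubic3 e1_def f1_def h1_def i1_def power_mult_distrib\<close>)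
  \<comment> \<open>All terms containing \<open>x\<close> are divisible by \<open>z\<close>, so the
    square in \<open>x\<close> can be completed by a linear change. A shift of \<open>y\<close> by a
    multiple of \<open>z\<close> then removes \<open>y^2 z\<close>.\<close>
  define h2 i2 j2 where "h2 = h1 - e1 ^ 2 / 4" and "i2 = i1 - e1 * f1 / 2" and "j2 = j - f1 ^ 2 / 4"
  have 2: "graded_equiv 1 1 1 (cubic3 0 0 1 0 e1 f1 1 h1 i1 j) (cubic3 0 0 1 0 0 0 1 h2 i2 j2)"
    by (rule graded_equiv_linear[of 1 1 1 0 0 "- e1 / 2" 0 0 "- f1 / 2"])
      (simp_all add: eval3_cubic3 h2_def i2_def j2_def field_simps power2_eq_square power3_eq_cube)
  have 3: "graded_equiv 1 1 1 (cubic3 0 0 1 0 0 0 1 h2 i2 j2)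
      (cubic3 0 0 1 0 0 0 1 0 (i2 - h2 ^ 2 / 3) (j2 - h2 * i2 / 3 + 2 * h2 ^ 3 / 27))"
    by (rule graded_equiv_linear[of 1 1 1 "- h2 / 3" 0 0 0 0 0])
      (simp_all add: eval3_cubic3 field_simps power2_eq_square power3_eq_cube)
  show thesis
    using that graded_equiv_trans[OF graded_equiv_trans[OF 1 2] 3] .
qed

section \<open>From Weierstrass form to Hesse form\<close>

text \<open>
  A cubic has the form \<open>(x + y + z)\<^sup>3 + \<kappa> x y z\<close> when three of its flex tangents are the sides of a
  triangle and the three flexes are collinear. Here one tangent is \<open>z = 0\<close>, the line of flexes is
  \<open>y + s z = 0\<close>, and the other two tangents are \<open>x = m y + n z\<close> and its image under \<open>x \<mapsto> - x\<close>: the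
  equations for \<open>s\<close>, \<open>m\<close> and \<open>n\<close> express that the cubic is
  \<open>(x\<^sup>2 - (m y + n z)\<^sup>2) z + (y + s z)\<^sup>3\<close>.
\<close>

lemma triangle_of_weierstrass_form:
  fixes \<alpha> \<beta> :: "'k::{alg_closed_field, field_char_0}"
  assumes iso: "isolated_singularity (cubic3 0 0 1 0 0 0 1 0 \<alpha> \<beta>)"
  obtains \<kappa> where "\<kappa> \<noteq> 0"
    "graded_equiv 1 1 1 (cubic3 0 0 1 0 0 0 1 0 \<alpha> \<beta>) ((X + Y + Z) ^ 3 + const3 \<kappa> * X * Y * Z)"
proof -
  have disc: "4 * \<alpha> ^ 3 + 27 * \<beta> ^ 2 \<noteq> 0"
  proof
    assume 0: "4 * \<alpha> ^ 3 + 27 * \<beta> ^ 2 = 0"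
    show False
    proof (cases "\<alpha> = 0")
      case True
      then have "\<beta> = 0" using 0 by simp
      then show False using isolated_singularityD[OF iso, of 0 0 1] True by (auto simp: cubic3_def)
    next
      case False
      \<comment> \<open>When the discriminant vanishes, this is the double root of
        \<open>y^3 + \<alpha> y + \<beta>\<close>, and \<open>(0, y, 1)\<close> is singular.\<close>
      define y where "y = - 3 * \<beta> / (2 * \<alpha>)"
      have y: "2 * \<alpha> * y + 3 * \<beta> = 0" using False by (simp add: y_def)
      have "4 * \<alpha> ^ 2 * (3 * y ^ 2 + \<alpha>) = 3 * (2 * \<alpha> * y) ^ 2 + 4 * \<alpha> ^ 3"
        by (simp add: algebra_simps power2_eq_square power3_eq_cube)
      also have "2 * \<alpha> * y = - 3 * \<beta>" using y by (simp add: eq_neg_iff_add_eq_0)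
      finally have "4 * \<alpha> ^ 2 * (3 * y ^ 2 + \<alpha>) = 0" using 0 by (simp add: power_mult_distrib add.commute)
      then have "3 * y ^ 2 + \<alpha> = 0" using False by simp
      then show False
        using isolated_singularityD[OF iso, of 0 y 1] y by (auto simp: cubic3_def algebra_simps)
    qed
  qed
  \<comment> \<open>Comparing coefficients gives \<open>m^2 = 3 s\<close>,
    \<open>2 m n = 3 s^2 - \<alpha>\<close> and \<open>n^2 = s^3 - \<beta>\<close>. Eliminating
    \<open>m\<close> and \<open>n\<close> leaves this quartic, the 3-division polynomial at
    \<open>- s\<close>. A nonzero root is required because \<open>n\<close> is obtained by dividing
    by \<open>m\<close>; 0 is a root only for \<open>\<alpha> = 0\<close>.\<close>
  obtain s where "s \<noteq> 0" and s: "3 * s ^ 4 + 6 * \<alpha> * s ^ 2 - 12 * \<beta> * s - \<alpha> ^ 2 = 0"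
  proof (cases "\<alpha> = 0")
    case True
    then have "\<beta> \<noteq> 0" using disc by auto
    then obtain s where "s ^ 3 = 4 * \<beta>" "s \<noteq> 0" using nth_root_nonzero[of 3 "4 * \<beta>"] by auto
    moreover have "3 * s ^ 4 = 3 * s * s ^ 3" by (simp add: numeral_eq_Suc)
    ultimately show ?thesis using that[of s] True by simp
  next
    case False
    have "degree [:- (\<alpha> ^ 2), - 12 * \<beta>, 6 * \<alpha>, 0, 3:] > 0" by simp
    then obtain s where "poly [:- (\<alpha> ^ 2), - 12 * \<beta>, 6 * \<alpha>, 0, 3:] s = 0"
      using alg_closed_imp_poly_has_root by blast
    then have "3 * s ^ 4 + 6 * \<alpha> * s ^ 2 - 12 * \<beta> * s - \<alpha> ^ 2 = 0"
      by (simp add: algebra_simps numeral_eq_Suc)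
    moreover from this have "s \<noteq> 0" using False by auto
    ultimately show ?thesis using that by blast
  qed
  obtain m where m: "m ^ 2 = 3 * s" "m \<noteq> 0"
    using nth_root_nonzero[of 2 "3 * s"] \<open>s \<noteq> 0\<close> by auto
  define n where "n = (3 * s ^ 2 - \<alpha>) / (2 * m)"
  have n: "2 * m * n = 3 * s ^ 2 - \<alpha>" using m by (simp add: n_def)
  have \<beta>: "\<beta> = s ^ 3 - n ^ 2"
  proof -
    have "4 * m ^ 2 * n ^ 2 = (3 * s ^ 2 - \<alpha>) ^ 2"
      unfolding n [symmetric] by (simp add: power_mult_distrib)
    then have "12 * s * n ^ 2 = (3 * s ^ 2 - \<alpha>) ^ 2" by (simp add: m)
    then have "12 * s * (\<beta> - (s ^ 3 - n ^ 2)) = 0" using s by algebra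
    then show ?thesis using \<open>s \<noteq> 0\<close> by simp
  qed
  \<comment> \<open>Equality would force \<open>\<beta> = - 2 s^3\<close> and a vanishing
    discriminant. Geometrically, the line of flexes then passes through the intersection of the two
    tangents \<open>x = m y + n z\<close> and \<open>x = - (m y + n z)\<close>.\<close>
  have "3 * s ^ 2 + \<alpha> \<noteq> 0"
  proof
    assume "3 * s ^ 2 + \<alpha> = 0"
    then have \<alpha>: "\<alpha> = - 3 * s ^ 2" by (simp add: eq_neg_iff_add_eq_0 add.commute)
    have "12 * s * (\<beta> + 2 * s ^ 3) = 0" using s unfolding \<alpha> by algebra
    then have "\<beta> = - 2 * s ^ 3" using \<open>s \<noteq> 0\<close> by (simp add: eq_neg_iff_add_eq_0)
    with \<alpha> disc show False by (simp add: power_mult_distrib)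
  qed
  then have "m * s - n \<noteq> 0"
  proof -
    have "2 * m * (m * s - n) = 3 * s ^ 2 + \<alpha>" using m(1) n by algebra
    with \<open>3 * s ^ 2 + \<alpha> \<noteq> 0\<close> show ?thesis by auto
  qed
  \<comment> \<open>The new coordinates are proportional to the three sides; this scale makes their
    sum equal to \<open>y + s z\<close>.\<close>
  define \<sigma> where "\<sigma> = m / (m * s - n)"
  have \<sigma>: "\<sigma> \<noteq> 0" "m * (s * \<sigma> - 1) = n * \<sigma>"
    using \<open>m * s - n \<noteq> 0\<close> \<open>m \<noteq> 0\<close> by (simp_all add: \<sigma>_def field_simps)
  have "graded_equiv 1 1 1 (cubic3 0 0 1 0 0 0 1 0 \<alpha> \<beta>) ((X + Y + Z) ^ 3 + const3 (- 12 * s * \<sigma>) * X * Y * Z)"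
  proof (rule graded_equiv_linear[of "- m" 1 \<sigma> "1 - s * \<sigma>" 0 m 1 0 0])
    fix u v w
    define x y z where "x = m * (v - u)" and "y = u + v + (1 - s * \<sigma>) * w" and "z = \<sigma> * w"
    have \<alpha>: "\<alpha> = 3 * s ^ 2 - 2 * m * n" using n by (simp add: algebra_simps)
    have "x ^ 2 * z + y ^ 3 + \<alpha> * y * z ^ 2 + \<beta> * z ^ 3 =
        (x ^ 2 - (m * y + n * z) ^ 2) * z + (y + s * z) ^ 3 + (m ^ 2 - 3 * s) * y ^ 2 * z"
      unfolding \<alpha> \<beta> by (simp add: algebra_simps power2_eq_square power3_eq_cube)
    also have "m * y + n * z = m * (u + v)"
      unfolding y_def z_def using \<sigma>(2) by algebra
    also have "x ^ 2 - (m * (u + v)) ^ 2 = - 4 * m ^ 2 * u * v"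
      unfolding x_def by (simp add: algebra_simps power2_eq_square)
    also have "y + s * z = u + v + w"
      unfolding y_def z_def by (simp add: algebra_simps)
    finally have "x ^ 2 * z + y ^ 3 + \<alpha> * y * z ^ 2 + \<beta> * z ^ 3 = (u + v + w) ^ 3 + (- 12 * s * \<sigma>) * u * v * w"
      by (simp add: m z_def algebra_simps)
    then show "eval3 ((X + Y + Z) ^ 3 + const3 (- 12 * s * \<sigma>) * X * Y * Z) u v w =
      eval3 (cubic3 0 0 1 0 0 0 1 0 \<alpha> \<beta>) (- m * u + m * v + 0 * w) (1 * u + 1 * v + (1 - s * \<sigma>) * w) (0 * u + 0 * v + \<sigma> * w)"
      by (simp add: eval3_cubic3 x_def y_def z_def algebra_simps)
  qed (use \<sigma> m in simp)
  then show thesis using that[of "- 12 * s * \<sigma>"] \<sigma> \<open>s \<noteq> 0\<close> by simp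
qed

lemma hesse_of_triangle_form:
  fixes \<kappa> :: "'k::{alg_closed_field, field_char_0}"
  assumes "\<kappa> \<noteq> 0" and iso: "isolated_singularity ((X + Y + Z) ^ 3 + const3 \<kappa> * X * Y * Z)"
  obtains l where "graded_equiv 1 1 1 ((X + Y + Z) ^ 3 + const3 \<kappa> * X * Y * Z)
    (X ^ 3 + Y ^ 3 + Z ^ 3 + const3 l * X * Y * Z)"
proof -
  obtain w where w: "w ^ 2 + w + 1 = (0 :: 'k)"
    using quadratic_root[of 1 1 "1 :: 'k"] by auto
  define \<mu> where "\<mu> = 27 + \<kappa>"
  \<comment> \<open>For a primitive cube root of unity \<open>w\<close>, the product of \<open>u + v + t\<close>, \<open>u + w v + w\<^sup>2 t\<close> and
    \<open>u + w\<^sup>2 v + w t\<close> is \<open>u\<^sup>3 + v\<^sup>3 + t\<^sup>3 - 3 u v t\<close>, and their sum is \<open>3 u\<close>.\<close>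
  define p where "p = const3 \<mu> * X ^ 3 + const3 \<kappa> * Y ^ 3 + const3 \<kappa> * Z ^ 3 + const3 (- 3 * \<kappa>) * X * Y * Z"
  have 1: "graded_equiv 1 1 1 ((X + Y + Z) ^ 3 + const3 \<kappa> * X * Y * Z) p"
  proof (rule graded_equiv_linear[of 1 w w "w ^ 2" "w ^ 2" 1 1 1 1])
    \<comment> \<open>The determinant of the Fourier matrix of order 3; its square is
      \<open>- 27\<close>.\<close>
    show "1 * (w * w - w ^ 2 * w ^ 2) - 1 * (1 * w - w ^ 2 * 1) + 1 * (1 * w ^ 2 - w * 1) \<noteq> 0"
    proof
      assume "1 * (w * w - w ^ 2 * w ^ 2) - 1 * (1 * w - w ^ 2 * 1) + 1 * (1 * w ^ 2 - w * 1) = 0"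
      then have "27 = (0 :: 'k)" using w by algebra
      then show False by simp
    qed
    fix u v t
    define A B C where "A = 1 * u + 1 * v + 1 * t" and "B = 1 * u + w * v + w ^ 2 * t"
      and "C = 1 * u + w ^ 2 * v + w * t"
    have "A + B + C = 3 * u" "A * B * C = u ^ 3 + v ^ 3 + t ^ 3 - 3 * u * v * t"
      unfolding A_def B_def C_def using w by - (algebra+)
    moreover have "eval3 p u v t = (3 * u) ^ 3 + \<kappa> * (u ^ 3 + v ^ 3 + t ^ 3 - 3 * u * v * t)"
      by (simp add: p_def \<mu>_def power_mult_distrib algebra_simps)
    ultimately have "eval3 p u v t = (A + B + C) ^ 3 + \<kappa> * (A * B * C)"
      by (simp only:)
    then show "eval3 p u v t = eval3 ((X + Y + Z) ^ 3 + const3 \<kappa> * X * Y * Z)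
      (1 * u + 1 * v + 1 * t) (1 * u + w * v + w ^ 2 * t) (1 * u + w ^ 2 * v + w * t)"
      by (simp only: A_def B_def C_def eval3_simps mult.assoc)
  qed
  \<comment> \<open>For \<open>\<kappa> = - 27\<close> the triangle form would be singular at
    \<open>(1, 1, 1)\<close>, the image of \<open>(1, 0, 0)\<close>.\<close>
  have "\<mu> \<noteq> 0"
    using isolated_singularityD[OF isolated_singularity_linear_equiv[OF 1 iso], of 1 0 0]
    by (auto simp: p_def simp del: const3_simps const3_minus)
  obtain x where x: "x ^ 3 = 1 / (\<mu>)" "x \<noteq> 0"
    using nth_root_nonzero[of 3 "1 / (\<mu>)"] \<open>\<mu> \<noteq> 0\<close> by auto
  obtain y where y: "y ^ 3 = 1 / \<kappa>" "y \<noteq> 0"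
    using nth_root_nonzero[of 3 "1 / \<kappa>"] \<open>\<kappa> \<noteq> 0\<close> by auto
  have "graded_equiv 1 1 1 p (X ^ 3 + Y ^ 3 + Z ^ 3 + const3 (- 3 * \<kappa> * x * y * y) * X * Y * Z)"
  proof (rule graded_equiv_scale[of _ _ _ x y y])
    fix u v w
    have "(\<mu>) * (x * u) ^ 3 = u ^ 3" "\<kappa> * (y * v) ^ 3 = v ^ 3" "\<kappa> * (y * w) ^ 3 = w ^ 3"
      using \<open>\<mu> \<noteq> 0\<close> \<open>\<kappa> \<noteq> 0\<close> by (simp_all add: power_mult_distrib x y)
    then show "eval3 (X ^ 3 + Y ^ 3 + Z ^ 3 + const3 (- 3 * \<kappa> * x * y * y) * X * Y * Z) u v w
        = eval3 p (x * u) (y * v) (y * w)"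
      unfolding p_def eval3_simps by (simp only:) (simp add: algebra_simps)
  qed (use x y in simp_all)
  then show thesis using that 1 graded_equiv_trans by blast
qed

lemma classify_111:
  fixes p :: "'k::{alg_closed_field, field_char_0} poly3"
  assumes gr: "p \<in> graded_piece 1 1 1 3" and iso: "isolated_singularity p"
  obtains l where "graded_equiv 1 1 1 p (X ^ 3 + Y ^ 3 + Z ^ 3 + const3 l * X * Y * Z)"
proof -
  note iso' = isolated_singularity_linear_equiv[OF _ iso]
  obtain d e f g h i j where 1: "graded_equiv 1 1 1 p (cubic3 0 0 1 d e f g h i j)"
    using move_to_tangent[OF gr iso] .
  obtain c e f g h i j where 2: "graded_equiv 1 1 1 p (cubic3 0 0 c 0 e f g h i j)"
    using flex_form_of_tangent_form[OF iso'[OF 1]] graded_equiv_trans[OF 1] by metis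
  obtain \<alpha> \<beta> where 3: "graded_equiv 1 1 1 p (cubic3 0 0 1 0 0 0 1 0 \<alpha> \<beta>)"
    using weierstrass_of_flex_form[OF iso'[OF 2]] graded_equiv_trans[OF 2] by metis
  obtain \<kappa> where "\<kappa> \<noteq> 0" and 4: "graded_equiv 1 1 1 p ((X + Y + Z) ^ 3 + const3 \<kappa> * X * Y * Z)"
    using triangle_of_weierstrass_form[OF iso'[OF 3]] graded_equiv_trans[OF 3] by metis
  show thesis
    using hesse_of_triangle_form[OF \<open>\<kappa> \<noteq> 0\<close> iso'[OF 4]] graded_equiv_trans[OF 4] that by metis
qed

section \<open>Assembling the classification\<close>

lemma graded_piece_image_iff:
  assumes "graded_automorphism a b c \<phi>"
  shows "\<phi> p \<in> graded_piece a b c d \<longleftrightarrow> p \<in> graded_piece a b c d"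
proof -
  have "inj \<phi>" "\<phi> ` graded_piece a b c d = graded_piece a b c d"
    using assms by (auto simp: graded_automorphism_def bij_is_inj)
  then show ?thesis by (metis inj_image_mem_iff)
qed

lemma normal_forms_graded:
  fixes l :: "'k::comm_ring_1"
  shows "X ^ 3 + Y ^ 3 + Z ^ 3 + const3 l * X * Y * Z \<in> graded_piece 1 1 1 3"
    and "X ^ 4 + Y ^ 4 + Z ^ 2 + const3 l * X * Y * Z \<in> graded_piece 1 1 2 4"
    and "X ^ 6 + Y ^ 3 + Z ^ 2 + const3 l * X * Y * Z \<in> graded_piece 1 2 3 6"
proof -
  have gr: "X ^ i + Y ^ j + Z ^ k + const3 l * X * Y * Z \<in> graded_piece a b c d"
    if "a * i = d" "b * j = d" "c * k = d" "a + b + c = d" for a b c d i j k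
  proof -
    have "X ^ i + Y ^ j + Z ^ k + const3 l * (X * Y * Z) \<in> graded_piece a b c d"
      using graded_piece_power[OF graded_piece_vars(1)[of a b c, where 'k = 'k], of i]
        graded_piece_power[OF graded_piece_vars(2)[of a b c, where 'k = 'k], of j]
        graded_piece_power[OF graded_piece_vars(3)[of a b c, where 'k = 'k], of k]
        graded_piece_mult[OF graded_piece_mult[OF graded_piece_vars(1,2)[of a b c, where 'k = 'k]]
          graded_piece_vars(3)[of a b c, where 'k = 'k]] that
      by (intro graded_piece_add graded_piece_const_mult) simp_all
    then show ?thesis by (simp add: mult.assoc)
  qed
  show "X ^ 3 + Y ^ 3 + Z ^ 3 + const3 l * X * Y * Z \<in> graded_piece 1 1 1 3"
    "X ^ 4 + Y ^ 4 + Z ^ 2 + const3 l * X * Y * Z \<in> graded_piece 1 1 2 4"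
    "X ^ 6 + Y ^ 3 + Z ^ 2 + const3 l * X * Y * Z \<in> graded_piece 1 2 3 6"
    by (rule gr; simp)+
qed

theorem theorem0p3:
  fixes a b c :: nat
    and \<Omega> :: "'k::{alg_closed_field, field_char_0} poly3"
  assumes "1 \<le> a" and "a \<le> b" and "b \<le> c" and "gcd a (gcd b c) = 1"
  shows "(\<Omega> \<noteq> 0 \<and> \<Omega> \<in> graded_piece a b c (a + b + c) \<and> isolated_singularity \<Omega>)
    \<longleftrightarrow>
    (\<exists>\<phi>. graded_automorphism a b c \<phi> \<and>
      ((\<exists>l. (a, b, c) = (1, 1, 1) \<and> (- l) ^ 3 \<noteq> 27 \<and>
            \<phi> \<Omega> = X ^ 3 + Y ^ 3 + Z ^ 3 + const3 l * X * Y * Z) \<or>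
       (\<exists>l. (a, b, c) = (1, 1, 2) \<and> (- l) ^ 4 \<noteq> 64 \<and>
            \<phi> \<Omega> = X ^ 4 + Y ^ 4 + Z ^ 2 + const3 l * X * Y * Z) \<or>
       (\<exists>l. (a, b, c) = (1, 2, 3) \<and> (- l) ^ 6 \<noteq> 432 \<and>
            \<phi> \<Omega> = X ^ 6 + Y ^ 3 + Z ^ 2 + const3 l * X * Y * Z)))"
  (is "?L \<longleftrightarrow> ?R")
proof -
  have pos: "1 \<le> a" "1 \<le> b" "1 \<le> c" using assms by simp_all
  have sums: "1 + 1 + 1 = (3::nat)" "1 + 1 + 2 = (4::nat)" "1 + 2 + 3 = (6::nat)" by simp_all
  show ?thesis
  proof
    assume ?L
    then have gr: "\<Omega> \<in> graded_piece a b c (a + b + c)" and iso: "isolated_singularity \<Omega>" by auto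
    have iso_equiv: "isolated_singularity q" if "graded_equiv a b c \<Omega> q" for q
      using isolated_singularity_equiv[OF pos that iso] .
    consider "(a, b, c) = (1, 1, 1)" | "(a, b, c) = (1, 1, 2)" | "(a, b, c) = (1, 2, 3)"
      using admissible_weights[OF assms gr iso] by blast
    then show ?R
    proof cases
      case 1
      then have "\<Omega> \<in> graded_piece 1 1 1 3" using gr 1 by (simp only: prod.inject sums)
      then obtain l where l: "graded_equiv 1 1 1 \<Omega> (X ^ 3 + Y ^ 3 + Z ^ 3 + const3 l * X * Y * Z)"
        using classify_111[OF _ iso] by blast
      then have "(- l) ^ 3 \<noteq> 27" using iso_equiv isolated_singularity_hesse_iff 1 by blast
      then show ?thesis using l 1 unfolding graded_equiv_def by blast
    next
      case 2
      then have "\<Omega> \<in> graded_piece 1 1 2 4" using gr 2 by (simp only: prod.inject sums)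
      then obtain l where l: "graded_equiv 1 1 2 \<Omega> (X ^ 4 + Y ^ 4 + Z ^ 2 + const3 l * X * Y * Z)"
        using classify_112[OF _ iso] by blast
      then have "(- l) ^ 4 \<noteq> 64" using iso_equiv isolated_singularity_112_iff 2 by blast
      then show ?thesis using l 2 unfolding graded_equiv_def by blast
    next
      case 3
      then have "\<Omega> \<in> graded_piece 1 2 3 6" using gr 3 by (simp only: prod.inject sums)
      then obtain l where l: "graded_equiv 1 2 3 \<Omega> (X ^ 6 + Y ^ 3 + Z ^ 2 + const3 l * X * Y * Z)"
        using classify_123[OF _ iso] by blast
      then have "(- l) ^ 6 \<noteq> 432" using iso_equiv isolated_singularity_123_iff 3 by blast
      then show ?thesis using l 3 unfolding graded_equiv_def by blast
    qed
  next
    assume ?R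
    then obtain \<phi> l where aut: "graded_automorphism a b c \<phi>"
      and cases: "(a, b, c) = (1, 1, 1) \<and> (- l) ^ 3 \<noteq> 27 \<and> \<phi> \<Omega> = X ^ 3 + Y ^ 3 + Z ^ 3 + const3 l * X * Y * Z \<or>
        (a, b, c) = (1, 1, 2) \<and> (- l) ^ 4 \<noteq> 64 \<and> \<phi> \<Omega> = X ^ 4 + Y ^ 4 + Z ^ 2 + const3 l * X * Y * Z \<or>
        (a, b, c) = (1, 2, 3) \<and> (- l) ^ 6 \<noteq> 432 \<and> \<phi> \<Omega> = X ^ 6 + Y ^ 3 + Z ^ 2 + const3 l * X * Y * Z"
      by blast
    have "\<phi> \<Omega> \<in> graded_piece a b c (a + b + c) \<and> isolated_singularity (\<phi> \<Omega>)"
      using cases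
      by (elim disjE conjE)
        (simp_all only: prod.inject sums isolated_singularity_hesse_iff isolated_singularity_112_iff isolated_singularity_123_iff normal_forms_graded simp_thms)
    then have "\<Omega> \<in> graded_piece a b c (a + b + c)" and iso: "isolated_singularity \<Omega>"
      using graded_piece_image_iff[OF aut] isolated_singularity_image_iff[OF pos aut] by auto
    \<comment> \<open>The partials of the zero polynomial vanish everywhere, in particular at
      \<open>(1, 1, 1)\<close>.\<close>
    moreover have "\<Omega> \<noteq> 0"
      using isolated_singularityD[OF iso, of 1 1 1] by (auto simp: dX_def dY_def dZ_def)
    ultimately show ?L by blast
  qed
qed

end
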